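(* Fix $L\ge 20$. For any pattern $(\mathbf a,\mathbf e)$ there exists $S\subseteq V(\Gamma)$ such that \[\tilde p((\mathbf a,\mathbf e)_S)\ge \frac{p(\mathbf a,\mathbf e)}{2}-55L\sqrt d\] and, for $G$ a random $n$-lift of $H$, \[\mathbb{P}\big((\mathbf a,\mathbf e)_S\text{ can be found in }G\big)\le C\prod_{(i,w)\in S,\,a_{i,w}>0}a_{i,w}^{d/4}\Big(\prod_{(i,w)\in S,\,a_{i,w}>0}\binom{n}{\min(a_{i,w},\lfloor n/2\rfloor)}\Big)^{1-L/10},\] where $C$ is a constant not depending on $n$ or on the pattern.
   Context: $d\ge2$ and $H$ is a $d$-regular graph on $[h]$. A random $n$-lift $G$ of $H$ has vertex set $\{(i,j):i\in[h],j\in[n]\}$, fibres $V_i=\{(i,j):j\in[n]\}$, and for each $ii'\in E(H)$ an independent uniformly random perfect matching between $V_i$ and $V_{i'}$ (no other edges). Let $D^{>0}=\{2^k/\sqrt{nh}:k\in\mathbb{Z},k\ge0\}$ and let $\Gamma$ be the graph on $[h]\times D^{>0}$ with $(i,w)\sim_\Gamma(i',w')$ iff $ii'\in E(H)$ and $w/w'\in(d^{-1/2},d^{1/2})$. A pattern is a pair $(\mathbf a,\mathbf e)$: $\mathbf a=(a_{i,w})_{(i,w)\in V(\Gamma)}$ nonnegative integers with $\sum_w a_{i,w}\le n$ for each $i$, $\sum w^2a_{i,w}\le10$, and some $w_0\in D^{>0}$ with $a_{i,w}=0$ unless $w_0\le w\le dw_0$; $\mathbf e=(e_{i,w,i',w'})$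 indexed by edges of $\Gamma$ (symmetric), integers with $0\le e_{i,w,i',w'}\le\min(a_{i,w},a_{i',w'})$. It can be found in $G$ if there are pairwise disjoint $A_{i,w}\subseteq V_i$ with $|A_{i,w}|=a_{i,w}$ and exactly $e_{i,w,i',w'}$ edges of $G$ between $A_{i,w}$ and $A_{i',w'}$ for each edge $(i,w)(i',w')$ of $\Gamma$. Potency: $p(\mathbf a,\mathbf e)=\big|\sum_{(i,w)(i',w')\in E(\Gamma)}ww'(e_{i,w,i',w'}-a_{i,w}a_{i',w'}/n)\big|$; also $\tilde p(\mathbf a,\mathbf e)=\max_{F\subseteq E(\Gamma)}\big|\sum_{(i,w)(i',w')\in F}ww'(e_{i,w,i',w'}-a_{i,w}a_{i',w'}/n)\big|$. For $S\subseteq V(\Gamma)$, the sub-pattern $(\mathbf a,\mathbf e)_S$ has $a'_{i,w}=a_{i,w}$ if $(i,w)\in S$ and $0$ otherwise, and $e'_{i,w,i',w'}=e_{i,w,i',w'}$ if both endpoints lie in $S$ and $0$ otherwise. *)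

theory Defs
  imports "HOL-Probability.Probability" "HOL-Combinatorics.Permutations"
begin

definition regular_graph :: "(nat \<Rightarrow> nat \<Rightarrow> bool) \<Rightarrow> nat \<Rightarrow> nat \<Rightarrow> bool" where
  "regular_graph adjH h d \<longleftrightarrow>
     (\<forall>i i'. adjH i i' \<longrightarrow> adjH i' i) \<and>
     (\<forall>i. \<not> adjH i i) \<and>
     (\<forall>i i'. adjH i i' \<longrightarrow> i < h \<and> i' < h) \<and>
     (\<forall>i<h. card {i'. adjH i i'} = d)"

text \<open>Weights: index k :: nat stands for w = 2^k / sqrt(n h) in D^{>0}.
  Vertices of Gamma are pairs (i,k) with i < h.\<close>
definition wt :: "nat \<Rightarrow> nat \<Rightarrow> nat \<Rightarrow> real" where
  "wt n h k = 2 ^ k / sqrt (real n * real h)"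

definition Gamma_adj ::
  "(nat \<Rightarrow> nat \<Rightarrow> bool) \<Rightarrow> nat \<Rightarrow> nat \<Rightarrow> nat \<Rightarrow> nat \<times> nat \<Rightarrow> nat \<times> nat \<Rightarrow> bool" where
  "Gamma_adj adjH d n h v v' \<longleftrightarrow>
     fst v < h \<and> fst v' < h \<and> adjH (fst v) (fst v') \<and>
     1 / sqrt (real d) < wt n h (snd v) / wt n h (snd v') \<and>
     wt n h (snd v) / wt n h (snd v') < sqrt (real d)"

text \<open>Unordered edges of Gamma, each represented once as (v,v') with fst v < fst v'
  (H has no loops, so the two endpoints lie in different fibres).\<close>
definition Gamma_edges ::
  "(nat \<Rightarrow> nat \<Rightarrow> bool) \<Rightarrow> nat \<Rightarrow> nat \<Rightarrow> nat \<Rightarrow> ((nat \<times> nat) \<times> (nat \<times> nat)) set" where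
  "Gamma_edges adjH d n h = {(v, v'). Gamma_adj adjH d n h v v' \<and> fst v < fst v'}"

text \<open>Patterns: a v = a_{i,w}, e v v' = e_{i,w,i',w'} (only values on Gamma-edges matter).\<close>
definition is_pattern ::
  "(nat \<Rightarrow> nat \<Rightarrow> bool) \<Rightarrow> nat \<Rightarrow> nat \<Rightarrow> nat \<Rightarrow> (nat \<times> nat \<Rightarrow> nat)
     \<Rightarrow> (nat \<times> nat \<Rightarrow> nat \<times> nat \<Rightarrow> nat) \<Rightarrow> bool" where
  "is_pattern adjH d n h a e \<longleftrightarrow>
     (\<forall>v. h \<le> fst v \<longrightarrow> a v = 0) \<and>
     (\<forall>i<h. (\<Sum>k | a (i, k) \<noteq> 0. a (i, k)) \<le> n) \<and>
     (\<Sum>v | a v \<noteq> 0. (wt n h (snd v))\<^sup>2 * real (a v)) \<le> 10 \<and>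
     (\<exists>k0. \<forall>v. a v \<noteq> 0 \<longrightarrow> wt n h k0 \<le> wt n h (snd v) \<and> wt n h (snd v) \<le> real d * wt n h k0) \<and>
     (\<forall>v v'. Gamma_adj adjH d n h v v' \<longrightarrow>
        e v v' = e v' v \<and> e v v' \<le> min (a v) (a v'))"

definition edge_term ::
  "nat \<Rightarrow> nat \<Rightarrow> (nat \<times> nat \<Rightarrow> nat) \<Rightarrow> (nat \<times> nat \<Rightarrow> nat \<times> nat \<Rightarrow> nat)
     \<Rightarrow> (nat \<times> nat) \<times> (nat \<times> nat) \<Rightarrow> real" where
  "edge_term n h a e f = (case f of (v, v') \<Rightarrow>
     wt n h (snd v) * wt n h (snd v') * (real (e v v') - real (a v) * real (a v') / real n))"

definition potency ::
  "(nat \<Rightarrow> nat \<Rightarrow> bool) \<Rightarrow> nat \<Rightarrow> nat \<Rightarrow> nat \<Rightarrow> (nat \<times> nat \<Rightarrow> nat)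
     \<Rightarrow> (nat \<times> nat \<Rightarrow> nat \<times> nat \<Rightarrow> nat) \<Rightarrow> real" where
  "potency adjH d n h a e = \<bar>\<Sum>\<^sub>\<infinity>f\<in>Gamma_edges adjH d n h. edge_term n h a e f\<bar>"

definition potency_tilde ::
  "(nat \<Rightarrow> nat \<Rightarrow> bool) \<Rightarrow> nat \<Rightarrow> nat \<Rightarrow> nat \<Rightarrow> (nat \<times> nat \<Rightarrow> nat)
     \<Rightarrow> (nat \<times> nat \<Rightarrow> nat \<times> nat \<Rightarrow> nat) \<Rightarrow> real" where
  "potency_tilde adjH d n h a e =
     (SUP F \<in> Pow (Gamma_edges adjH d n h). \<bar>\<Sum>\<^sub>\<infinity>f\<in>F. edge_term n h a e f\<bar>)"

definition sub_a :: "(nat \<times> nat) set \<Rightarrow> (nat \<times> nat \<Rightarrow> nat) \<Rightarrow> nat \<times> nat \<Rightarrow> nat" where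
  "sub_a S a = (\<lambda>v. if v \<in> S then a v else 0)"

definition sub_e :: "(nat \<times> nat) set \<Rightarrow> (nat \<times> nat \<Rightarrow> nat \<times> nat \<Rightarrow> nat)
     \<Rightarrow> nat \<times> nat \<Rightarrow> nat \<times> nat \<Rightarrow> nat" where
  "sub_e S e = (\<lambda>v v'. if v \<in> S \<and> v' \<in> S then e v v' else 0)"

text \<open>n-lifts: for each edge ii' of H with i < i', a permutation sigma(i,i') of [n]
  encodes the perfect matching (i,j) -- (i', sigma(i,i') j).  A uniformly random
  permutation is the same as a uniformly random perfect matching.\<close>
definition lifts :: "(nat \<Rightarrow> nat \<Rightarrow> bool) \<Rightarrow> nat \<Rightarrow> nat \<Rightarrow> (nat \<times> nat \<Rightarrow> nat \<Rightarrow> nat) set" where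
  "lifts adjH h n = {\<sigma>. \<forall>i i'.
      (i < i' \<and> i' < h \<and> adjH i i' \<longrightarrow> \<sigma> (i, i') permutes {..<n}) \<and>
      (\<not> (i < i' \<and> i' < h \<and> adjH i i') \<longrightarrow> \<sigma> (i, i') = id)}"

definition lift_adj :: "(nat \<Rightarrow> nat \<Rightarrow> bool) \<Rightarrow> nat \<Rightarrow> nat \<Rightarrow> (nat \<times> nat \<Rightarrow> nat \<Rightarrow> nat)
     \<Rightarrow> nat \<times> nat \<Rightarrow> nat \<times> nat \<Rightarrow> bool" where
  "lift_adj adjH h n \<sigma> x y \<longleftrightarrow>
     fst x < h \<and> fst y < h \<and> snd x < n \<and> snd y < n \<and>
     ((fst x < fst y \<and> adjH (fst x) (fst y) \<and> \<sigma> (fst x, fst y) (snd x) = snd y) \<or>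
      (fst y < fst x \<and> adjH (fst y) (fst x) \<and> \<sigma> (fst y, fst x) (snd y) = snd x))"

text \<open>A pattern can be found in the lift given by sigma: A v is the set of second
  coordinates of A_{i,w} (a subset of the fibre V_i), v = (i,k).\<close>
definition found_in ::
  "(nat \<Rightarrow> nat \<Rightarrow> bool) \<Rightarrow> nat \<Rightarrow> nat \<Rightarrow> nat \<Rightarrow> (nat \<times> nat \<Rightarrow> nat \<Rightarrow> nat)
     \<Rightarrow> (nat \<times> nat \<Rightarrow> nat) \<Rightarrow> (nat \<times> nat \<Rightarrow> nat \<times> nat \<Rightarrow> nat) \<Rightarrow> bool" where
  "found_in adjH d n h \<sigma> a e \<longleftrightarrow>
     (\<exists>A :: nat \<times> nat \<Rightarrow> nat set.
        (\<forall>v. fst v < h \<longrightarrow> A v \<subseteq> {..<n} \<and> card (A v) = a v) \<and>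
        (\<forall>v v'. fst v < h \<and> fst v = fst v' \<and> v \<noteq> v' \<longrightarrow> A v \<inter> A v' = {}) \<and>
        (\<forall>v v'. Gamma_adj adjH d n h v v' \<longrightarrow>
           card {(j, j'). j \<in> A v \<and> j' \<in> A v' \<and> lift_adj adjH h n \<sigma> (fst v, j) (fst v', j')}
             = e v v'))"

definition prob_found ::
  "(nat \<Rightarrow> nat \<Rightarrow> bool) \<Rightarrow> nat \<Rightarrow> nat \<Rightarrow> nat
     \<Rightarrow> (nat \<times> nat \<Rightarrow> nat) \<Rightarrow> (nat \<times> nat \<Rightarrow> nat \<times> nat \<Rightarrow> nat) \<Rightarrow> real" where
  "prob_found adjH d n h a e =
     measure_pmf.prob (pmf_of_set (lifts adjH h n)) {\<sigma>. found_in adjH d n h \<sigma> a e}"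

end

theory Submission
  imports Defs
begin

text \<open>
  For fixed vertex classes, an exponential moment bound for a uniformly random matching between two
  fibres shows that the prescribed edge counts \<open>e\<close> occur with probability at most
  \<open>exp (- \<Sum> D)\<close> up to a polynomial factor, where \<open>D = e ln (e / m) - e + m\<close> is the relative
  entropy cost of seeing \<open>e\<close> edges instead of the mean \<open>m = a a' / n\<close>.  The polynomial factor is
  the product of the square roots of the class sizes of either fibre, whence, by a geometric mean,
  the exponent \<open>d / 4\<close>.  A union bound over the classes costs \<open>b v = ln (n choose a v)\<close> per vertex
  \<open>v\<close> of \<open>Gamma\<close>.

  Delete vertices \<open>v\<close> with \<open>\<Sum> D < (L / 5) b v\<close>, the sum running over the edges at \<open>v\<close>, until
  none is left.  On the remaining set \<open>S\<close> the entropy beats the union bound.  Each deleted edge is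
  charged to its endpoint deleted first, and an argument in the style of Kahn and Szemeredi bounds
  the potency lost: edges with \<open>e \<le> 8 m\<close> by Cauchy--Schwarz, the others by comparing
  \<open>ln (e / m)\<close> with \<open>ln (n / a)\<close>.
\<close>

section \<open>Elementary estimates\<close>

text \<open>The polynomial factor must contain no power of \<open>n\<close>. Stirling's formula
  costs the square root of the size of every colour class of a fibre, including the class of
  vertices that belong to no set of the pattern, and that class can have size close to
  \<open>n\<close>. Its square root is absorbed by the \<open>sqrt n\<close> in the lower bound for
  \<open>fact n\<close>. What else remains is one factor e per class. The weights of a pattern lie
  in a window of ratio \<open>d\<close>, so a fibre has at most \<open>d\<close> classes and the
  constant depends on \<open>d\<close> and \<open>h\<close> only. In the exponent
  \<open>1 - L / 10\<close> the 1 is the union bound; \<open>L / 10\<close> is half of the threshold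
  \<open>L / 5\<close>, because an edge inside \<open>S\<close> is counted at both of its endpoints.
  The loss of potency must not grow with the number of weight levels. Weights are dyadic, so sums
  over levels become geometric once the entropy ln (n / a) is traded for a small power of n / a. The
  ratio 8 separating the two regimes exceeds e^2: above it the term \<open>e ln (e / m)\<close>
  dominates the linear term, below it the deviation is quadratic.\<close>

definition rel_dev :: "real \<Rightarrow> real \<Rightarrow> real" where
  "rel_dev x m = x * ln (x / m) - x + m"

text \<open>At x = 1 + 1/n the left side is exactly 1 / (n + 1/2), which makes the Stirling sequence
  decrease. The same bound gives the quadratic growth of \<open>rel_dev\<close> above the
  mean.\<close>

lemma ln_ge_pade:
  assumes "1 \<le> (x::real)"
  shows "2 * (x - 1) / (x + 1) \<le> ln x"
proof -
  let ?g = "\<lambda>x::real. ln x - 2 * (x - 1) / (x + 1)"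
  have "?g 1 \<le> ?g x"
  proof (rule DERIV_nonneg_imp_nondecreasing[OF assms], goal_cases)
    case (1 y)
    have "(?g has_real_derivative (1 / y - 4 / (y + 1)\<^sup>2)) (at y)"
      using 1 by (auto intro!: derivative_eq_intros simp: field_simps power2_eq_square)
    moreover have "1 / y - 4 / (y + 1)\<^sup>2 = (y - 1)\<^sup>2 / (y * (y + 1)\<^sup>2)"
      using 1 by (simp add: divide_simps power2_eq_square) (simp add: algebra_simps)
    ultimately show ?case using 1 by (intro exI conjI) auto
  qed
  then show ?thesis by simp
qed

text \<open>At x = 1 + 1/n, multiplied by n + 1/2, the right side is 1 plus the telescoping error
  1/(4n) - 1/(4(n+1)). Applied to 1/r it handles \<open>rel_dev\<close> below the mean.\<close>

lemma ln_le_half_diff_inverse: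
  assumes "1 \<le> (x::real)"
  shows "ln x \<le> (x - 1 / x) / 2"
proof -
  let ?g = "\<lambda>x::real. (x - 1 / x) / 2 - ln x"
  have "?g 1 \<le> ?g x"
  proof (rule DERIV_nonneg_imp_nondecreasing[OF assms], goal_cases)
    case (1 y)
    have "(?g has_real_derivative ((1 + 1 / y\<^sup>2) / 2 - 1 / y)) (at y)"
      using 1 by (auto intro!: derivative_eq_intros simp: field_simps power2_eq_square)
    moreover have "(1 + 1 / y\<^sup>2) / 2 - 1 / y = (y - 1)\<^sup>2 / (2 * y\<^sup>2)"
      using 1 by (simp add: divide_simps power2_eq_square) (simp add: algebra_simps)
    ultimately show ?case using 1 by (intro exI conjI) auto
  qed
  then show ?thesis by simp
qed

text \<open>For \<open>s n = ln (n!) + n - (n + 1/2) ln n\<close> the sequence \<open>s n\<close> decreases while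
  \<open>s n - 1 / (4 n)\<close> increases.\<close>

lemma ln_fact_bounds:
  assumes "1 \<le> n"
  shows "ln (fact n) + n - (n + 1/2) * ln n \<le> 1"
    and "3/4 + 1 / (4 * real n) \<le> ln (fact n) + n - (n + 1/2) * ln n"
proof -
  have "ln (fact n) + n - (n + 1/2) * ln n \<le> (1::real) \<and>
        3/4 + 1 / (4 * real n) \<le> ln (fact n) + n - (n + 1/2) * ln n"
    using assms
  proof (induction n rule: dec_induct)
    case base
    then show ?case by simp
  next
    case (step n)
    define x where "x = 1 + 1 / real n"
    have n: "real n > 0" using step by simp
    have x: "x \<ge> 1" by (simp add: x_def)
    have lnx: "ln (real (Suc n)) = ln n + ln x"
    proof -
      have "ln (real n * x) = ln n + ln x" using n x by (simp add: ln_mult)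
      moreover have "real n * x = real (Suc n)" using n by (simp add: x_def field_simps)
      ultimately show ?thesis by simp
    qed
    have lnf: "ln (fact (Suc n)) = ln (real (Suc n)) + ln (fact n :: real)"
      by (simp add: ln_mult del: of_nat_Suc)
    have eq: "ln (fact (Suc n)) + real (Suc n) - (real (Suc n) + 1/2) * ln (real (Suc n))
       = (ln (fact n) + real n - (real n + 1/2) * ln n) + 1 - (real n + 1/2) * ln x"
      unfolding lnf lnx by (simp add: algebra_simps)
    have "(real n + 1/2) * (2 * (x - 1) / (x + 1)) = 1"
      using n by (simp add: x_def divide_simps)
    moreover have "(real n + 1/2) * (2 * (x - 1) / (x + 1)) \<le> (real n + 1/2) * ln x"
      by (intro mult_left_mono ln_ge_pade x) auto
    ultimately have 1: "(real n + 1/2) * ln x \<ge> 1" by linarith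
    have "(real n + 1/2) * ((x - 1 / x) / 2) = 1 + (1 / (4 * real n) - 1 / (4 * real (Suc n)))"
      using n by (simp add: x_def divide_simps) (simp add: algebra_simps)
    moreover have "(real n + 1/2) * ln x \<le> (real n + 1/2) * ((x - 1 / x) / 2)"
      by (intro mult_left_mono ln_le_half_diff_inverse x) auto
    ultimately have 2: "(real n + 1/2) * ln x \<le> 1 + (1 / (4 * real n) - 1 / (4 * real (Suc n)))"
      by simp
    show ?case using step.IH 1 2 unfolding eq by linarith
  qed
  then show "ln (fact n) + n - (n + 1/2) * ln n \<le> 1"
    and "3/4 + 1 / (4 * real n) \<le> ln (fact n) + n - (n + 1/2) * ln n"
    by blast+
qed

lemma exp_ln_half:
  assumes "1 \<le> n"
  shows "exp ((real n + 1/2) * ln n) = real n ^ n * sqrt n"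
proof -
  have "exp ((real n + 1/2) * ln n) = real n powr real n * real n powr (1/2)"
    using assms by (simp add: powr_def exp_add[symmetric] algebra_simps)
  then show ?thesis using assms by (simp add: powr_realpow powr_half_sqrt)
qed

lemma fact_le_stirling:
  assumes "1 \<le> n"
  shows "fact n \<le> exp 1 * sqrt n * (real n ^ n * exp (- real n))"
proof -
  have "fact n = exp (ln (fact n :: real))" by simp
  also have "\<dots> \<le> exp (1 + (real n + 1/2) * ln n + - real n)"
    using ln_fact_bounds(1)[OF assms] by (subst exp_le_cancel_iff) linarith
  also have "\<dots> = exp 1 * sqrt n * (real n ^ n * exp (- real n))"
    by (simp only: exp_add exp_ln_half[OF assms]) (simp only: mult_ac)
  finally show ?thesis .
qed

text \<open>The constant sqrt (2 pi) is weakened to 1 here and to e in the upper bound. The factor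
  \<open>sqrt n\<close> must be kept: it later cancels the vertices outside all classes.\<close>

lemma fact_ge_stirling:
  assumes "1 \<le> n"
  shows "sqrt n * (real n ^ n * exp (- real n)) \<le> fact n"
proof -
  have "sqrt n * (real n ^ n * exp (- real n)) = exp ((real n + 1/2) * ln n + - real n)"
    by (simp only: exp_add exp_ln_half[OF assms]) (simp only: mult_ac)
  also have "\<dots> \<le> exp (ln (fact n :: real))"
  proof (subst exp_le_cancel_iff)
    have "0 \<le> 1 / (4 * real n)" by simp
    with ln_fact_bounds(2)[OF assms]
    show "(real n + 1/2) * ln n + - real n \<le> ln (fact n)" by linarith
  qed
  also have "\<dots> = fact n" by simp
  finally show ?thesis .
qed

text \<open>With r = x / m, the rational bound on ln gives (r - 1)^2 / (r + 1) for r at least 1, and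
  r + 1 is at most 9. Below the mean the constant 2 already suffices.\<close>

lemma rel_dev_ge_square:
  assumes "0 \<le> x" "0 < m" "x \<le> 8 * m"
  shows "(x - m)\<^sup>2 \<le> 9 * m * rel_dev x m"
proof -
  define r where "r = x / m"
  have r: "0 \<le> r" "r \<le> 8" "x = r * m" using assms by (auto simp: r_def field_simps)
  have "(r - 1)\<^sup>2 \<le> 9 * (r * ln r - r + 1)"
  proof (cases "r \<ge> 1")
    case True
    have "(r - 1)\<^sup>2 / (r + 1) = r * (2 * (r - 1) / (r + 1)) - r + 1"
      using True by (simp add: divide_simps power2_eq_square) (simp add: algebra_simps)
    also have "\<dots> \<le> r * ln r - r + 1"
      using mult_left_mono[OF ln_ge_pade[OF True] r(1)] by linarith
    finally have *: "(r - 1)\<^sup>2 / (r + 1) \<le> r * ln r - r + 1" .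
    then have "(r - 1)\<^sup>2 / (r + 1) * (r + 1) \<le> (r * ln r - r + 1) * (r + 1)"
      using r by (intro mult_right_mono) auto
    moreover have "0 \<le> (r - 1)\<^sup>2 / (r + 1)" using r by auto
    then have "0 \<le> r * ln r - r + 1" using * by linarith
    then have "(r * ln r - r + 1) * (r + 1) \<le> (r * ln r - r + 1) * 9"
      using r by (intro mult_left_mono) auto
    ultimately show ?thesis using True by simp
  next
    case False
    show ?thesis
    proof (cases "r = 0")
      case False
      with r have r0: "r > 0" by simp
      have "ln (1 / r) \<le> (1 / r - 1 / (1 / r)) / 2"
        using \<open>\<not> 1 \<le> r\<close> r0 by (intro ln_le_half_diff_inverse) auto
      then have "r * - ln r \<le> r * ((1 / r - r) / 2)"
        using r0 by (intro mult_left_mono) (auto simp: ln_div)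
      also have "\<dots> = (1 - r\<^sup>2) / 2" using r0 by (simp add: field_simps power2_eq_square)
      finally have "(r - 1)\<^sup>2 \<le> 2 * (r * ln r - r + 1)"
        by (simp add: power2_eq_square field_simps)
      then show ?thesis by (smt (verit) zero_le_power2)
    qed simp
  qed
  then have "(r - 1)\<^sup>2 * m\<^sup>2 \<le> 9 * (r * ln r - r + 1) * m\<^sup>2"
    by (intro mult_right_mono) auto
  moreover have "(x - m)\<^sup>2 = (r - 1)\<^sup>2 * m\<^sup>2" using r(3)
    by (auto simp: power2_eq_square algebra_simps)
  moreover have "9 * m * rel_dev x m = 9 * (r * ln r - r + 1) * m\<^sup>2"
    unfolding rel_dev_def r_def[symmetric] using r(3) by (auto simp: power2_eq_square algebra_simps)
  ultimately show ?thesis by (simp only:)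
qed

lemma ln_8_ge_2: "2 \<le> ln (8::real)"
  using ln2_ge_two_thirds ln_realpow[of "2::real" 3] by simp

text \<open>Since ln 8 is at least 2, the term \<open>- x\<close> in \<open>rel_dev\<close> uses up
  at most half of \<open>x * ln (x / m)\<close>.\<close>

lemma rel_dev_ge_ln:
  assumes "0 < m" "8 * m < x"
  shows "2 \<le> ln (x / m)" "x * ln (x / m) \<le> 2 * rel_dev x m"
proof -
  have "ln 8 \<le> ln (x / m)" using assms by (subst ln_le_cancel_iff) (auto simp: field_simps)
  then show 1: "2 \<le> ln (x / m)" using ln_8_ge_2 by linarith
  have "0 \<le> x * (ln (x / m) - 2)" using 1 assms by (intro mult_nonneg_nonneg) auto
  then have "0 \<le> x * ln (x / m) - 2 * x" by (simp only: algebra_simps)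
  then show "x * ln (x / m) \<le> 2 * rel_dev x m" using assms unfolding rel_dev_def by argo
qed

lemma rel_dev_nonneg:
  assumes "0 \<le> x" "0 < m"
  shows "0 \<le> rel_dev x m"
proof (cases "x \<le> 8 * m")
  case True
  then have "0 \<le> 9 * m * rel_dev x m"
    using rel_dev_ge_square[OF assms True] by (smt (verit) zero_le_power2)
  then show ?thesis using assms by (simp add: zero_le_mult_iff)
next
  case False
  then have "0 \<le> x * ln (x / m)" "x * ln (x / m) \<le> 2 * rel_dev x m"
    using rel_dev_ge_ln[of m x] assms by (auto intro!: mult_nonneg_nonneg)
  then show ?thesis by linarith
qed

text \<open>A single term of the expansion of (1 + y)^n, at most exp (n y), at y = a / n. The
  separate \<open>m\<close> allows the truncated index \<open>min a (n div 2)\<close> with a bound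
  still expressed in \<open>a\<close>.\<close>

lemma choose_le_exp:
  fixes a n m :: nat
  assumes "1 \<le> a" "a \<le> n" "m \<le> a"
  shows "ln (n choose m) \<le> a * (1 + ln (n / a))"
proof (cases "m \<le> n")
  case True
  define y where "y = real a / real n"
  have y: "0 < y" "y \<le> 1" using assms by (auto simp: y_def)
  have "real (n choose m) * y ^ m \<le> (\<Sum>k\<le>n. real (n choose k) * y ^ k)"
    using True y by (intro member_le_sum) auto
  also have "\<dots> = (y + 1) ^ n" by (subst binomial_ring) simp
  also have "\<dots> \<le> exp y ^ n" using y exp_ge_add_one_self[of y] by (intro power_mono) (auto simp: add.commute)
  also have "\<dots> = exp (real a)" using assms by (simp add: exp_of_nat_mult[symmetric] y_def)
  finally have *: "real (n choose m) * y ^ m \<le> exp (real a)" .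
  have "ln (real (n choose m) * y ^ m) \<le> real a"
    using ln_mono[OF *] y True by simp
  moreover have "ln (real (n choose m) * y ^ m) = ln (n choose m) + m * ln y"
    using y True by (simp add: ln_mult ln_realpow)
  moreover have "m * ln y = - (m * ln (n / a))"
    using assms by (simp add: y_def ln_div algebra_simps)
  moreover have "real m * ln (n / a) \<le> real a * ln (n / a)"
    using assms by (intro mult_right_mono) auto
  ultimately have "ln (n choose m) \<le> real a + real a * ln (n / a)" by linarith
  then show ?thesis by (simp only: distrib_left mult_1_right)
qed (use assms in simp)

text \<open>Replaces the logarithm by a power, so that the later sums over dyadic levels converge
  geometrically. It is ln t \<le> t - 1 at t = 1 / sqrt y.\<close>

lemma entropy_le_sqrt:
  assumes "0 < (y::real)"
  shows "y * (1 + ln (1 / y)) \<le> 2 * sqrt y"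
proof -
  define z where "z = sqrt y"
  have z: "0 < z" "y = z\<^sup>2" using assms by (auto simp: z_def)
  have "ln (1 / y) = 2 * ln (1 / z)" using z by (simp add: ln_div ln_realpow)
  moreover have "ln (1 / z) \<le> 1 / z - 1" using z by (intro ln_le_minus_one) auto
  ultimately have "1 + ln (1 / y) \<le> 2 / z" by simp
  then have "y * (1 + ln (1 / y)) \<le> z\<^sup>2 * (2 / z)" unfolding z(2) by (intro mult_left_mono) auto
  then show ?thesis using z by (simp add: z_def[symmetric] power2_eq_square)
qed

section \<open>Edge counts in a random matching\<close>

lemma sqrt_prod: "sqrt (\<Prod>x\<in>A. f x) = (\<Prod>x\<in>A. sqrt (f x))"
  by (induction A rule: infinite_finite_induct) (auto simp: real_sqrt_mult)

lemma le_geometric_mean: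
  assumes "0 \<le> x" "x \<le> K * sqrt a" "x \<le> K * sqrt b" "0 \<le> K" "0 \<le> a" "0 \<le> b"
  shows "x \<le> K * (sqrt (sqrt a) * sqrt (sqrt b))"
proof -
  have "x * x \<le> (K * sqrt a) * (K * sqrt b)"
    using assms by (intro mult_mono) auto
  then have "sqrt (x * x) \<le> sqrt ((K * sqrt a) * (K * sqrt b))" by (rule real_sqrt_le_mono)
  also have "(K * sqrt a) * (K * sqrt b) = K\<^sup>2 * (sqrt a * sqrt b)"
    by (simp add: power2_eq_square mult_ac)
  also have "sqrt \<dots> = K * (sqrt (sqrt a) * sqrt (sqrt b))"
    using assms by (simp add: real_sqrt_mult)
  finally show ?thesis using assms by simp
qed

text \<open>Such a permutation is determined by its restrictions to the colour classes, each of
  which permutes its class: an injection into a product of symmetric groups.\<close>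

lemma card_colour_preserving_perms_le:
  assumes "finite N"
  shows "card {p. p permutes N \<and> (\<forall>j\<in>N. \<beta> (p j) = \<beta> j)}
           \<le> (\<Prod>t\<in>\<beta> ` N. fact (card {j\<in>N. \<beta> j = t}))" (is "card ?P \<le> _")
proof -
  let ?C = "\<lambda>t. {j\<in>N. \<beta> j = t}"
  let ?r = "\<lambda>p. \<lambda>t\<in>\<beta> ` N. \<lambda>j. if j \<in> ?C t then p j else j"
  have "inj_on ?r ?P"
  proof (rule inj_onI)
    fix p q assume p: "p \<in> ?P" and q: "q \<in> ?P" and eq: "?r p = ?r q"
    show "p = q"
    proof
      fix j show "p j = q j"
      proof (cases "j \<in> N")
        case True
        then have "?r p (\<beta> j) j = ?r q (\<beta> j) j" using eq by simp
        then show ?thesis using True by simp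
      next
        case False
        then show ?thesis using p q by (auto simp: permutes_not_in)
      qed
    qed
  qed
  moreover have "?r ` ?P \<subseteq> PiE (\<beta> ` N) (\<lambda>t. {p. p permutes ?C t})"
  proof (rule image_subsetI, rule PiE_I)
    fix p t assume p: "p \<in> ?P" and t: "t \<in> \<beta> ` N"
    have "(\<lambda>j. if j \<in> ?C t then p j else j) permutes ?C t"
    proof (rule inj_imp_permutes)
      show "inj_on (\<lambda>j. if j \<in> ?C t then p j else j) (?C t)"
        using p permutes_inj[of p N] by (auto simp: inj_on_def inj_def)
      show "(if j \<in> ?C t then p j else j) \<in> ?C t" if "j \<in> ?C t" for j
        using that p by (auto simp: permutes_in_image)
    qed (use assms in auto)
    then show "?r p t \<in> {p. p permutes ?C t}" using t by simp
  qed auto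
  ultimately have "card ?P \<le> card (PiE (\<beta> ` N) (\<lambda>t. {p. p permutes ?C t}))"
    by (intro card_inj_on_le[of ?r]) (auto intro!: finite_PiE finite_permutations assms)
  also have "\<dots> = (\<Prod>t\<in>\<beta> ` N. card {p. p permutes ?C t})"
    using assms by (intro card_PiE) auto
  also have "\<dots> = (\<Prod>t\<in>\<beta> ` N. fact (card (?C t)))"
    using assms by (intro prod.cong refl card_permutations) auto
  finally show ?thesis .
qed

text \<open>If nonempty, the set is a coset of the colour-preserving permutations; composing with
  the inverse of one member \<open>q\<close> reduces to them.\<close>

lemma card_perms_recolour_le:
  assumes "finite N"
  shows "card {p. p permutes N \<and> (\<forall>j\<in>N. \<beta> (p j) = c j)}
           \<le> (\<Prod>t\<in>\<beta> ` N. fact (card {j\<in>N. \<beta> j = t}))" (is "card ?P \<le> _")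
proof (cases "?P = {}")
  case True
  show ?thesis unfolding True by simp
next
  case False
  then obtain q where q: "q permutes N" "\<forall>j\<in>N. \<beta> (q j) = c j" by blast
  let ?Q = "{p. p permutes N \<and> (\<forall>j\<in>N. \<beta> (p j) = \<beta> j)}"
  have "card ?P \<le> card ?Q"
  proof (rule card_inj_on_le)
    show "inj_on (\<lambda>p. p \<circ> inv q) ?P"
    proof (rule inj_onI)
      fix p p' assume "p \<circ> inv q = p' \<circ> inv q"
      then have "p \<circ> (inv q \<circ> q) = p' \<circ> (inv q \<circ> q)" by (metis comp_assoc)
      then show "p = p'" using permutes_inv_o(2)[OF q(1)] by simp
    qed
    show "(\<lambda>p. p \<circ> inv q) ` ?P \<subseteq> ?Q"
    proof (rule image_subsetI, rule CollectI, rule conjI, goal_cases)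
      case (1 p)
      then show ?case using q by (auto intro!: permutes_compose permutes_inv)
    next
      case (2 p)
      show ?case
      proof
        fix j assume j: "j \<in> N"
        then have "inv q j \<in> N" using permutes_inv[OF q(1)] by (simp add: permutes_in_image)
        then have "\<beta> (p (inv q j)) = c (inv q j)" "\<beta> (q (inv q j)) = c (inv q j)" using 2 q by auto
        then show "\<beta> ((p \<circ> inv q) j) = \<beta> j" using permutes_inverses(1)[OF q(1)] by simp
      qed
    qed
    show "finite ?Q" using finite_permutations[OF assms] by (rule finite_subset[rotated]) auto
  qed
  then show ?thesis using card_colour_preserving_perms_le[OF assms, of \<beta>] by linarith
qed

text \<open>Colour classes of sizes \<open>b t\<close>: the sum over permutations is \<open>\<Prod> b t!\<close> times a coefficient
  of the product over \<open>j\<close> of \<open>\<Sum>t. F j t * y t\<close>, a polynomial in the variables \<open>y t\<close>; it is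
  bounded by evaluating that polynomial at \<open>y t = b t / n\<close>.\<close>

lemma sum_perms_prod_le:
  fixes F :: "'a \<Rightarrow> 't \<Rightarrow> real" and \<beta> :: "'a \<Rightarrow> 't"
  assumes N: "finite N" "N \<noteq> {}" and F: "\<And>j t. 0 \<le> F j t"
  defines "n \<equiv> real (card N)" and "b \<equiv> \<lambda>t. card {j\<in>N. \<beta> j = t}"
  shows "(\<Sum>p | p permutes N. \<Prod>j\<in>N. F j (\<beta> (p j))) * (\<Prod>t\<in>\<beta> ` N. (b t / n) ^ b t)
       \<le> (\<Prod>t\<in>\<beta> ` N. fact (b t)) * (\<Prod>j\<in>N. \<Sum>t\<in>\<beta> ` N. F j t * (b t / n))"
proof -
  let ?T = "\<beta> ` N" and ?y = "\<lambda>t. b t / n"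
  let ?M = "(\<Prod>t\<in>?T. fact (b t)) :: real"
  let ?g = "\<lambda>c. \<Prod>j\<in>N. F j (c j) * ?y (c j)"
  let ?r = "\<lambda>p. restrict (\<beta> \<circ> p) N"
  have fin: "finite {p. p permutes N}" using N by (simp add: finite_permutations)
  have n: "n > 0" using N by (simp add: n_def card_gt_0_iff)
  \<comment> \<open>A permutation only reorders the colours, so this monomial is the same for every
    \<open>p\<close> and can be moved into the sum.\<close>
  have "(\<Prod>j\<in>N. ?y (\<beta> (p j))) = (\<Prod>t\<in>?T. ?y t ^ b t)" if "p permutes N" for p
  proof -
    have "(\<Prod>j\<in>N. ?y (\<beta> (p j))) = (\<Prod>j\<in>N. ?y (\<beta> j))"
      using prod.permute[OF that, of "\<lambda>j. ?y (\<beta> j)"] by (simp add: o_def)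
    also have "\<dots> = (\<Prod>t\<in>?T. \<Prod>j | j \<in> N \<and> \<beta> j = t. ?y (\<beta> j))"
      using N by (intro prod.image_gen)
    also have "\<dots> = (\<Prod>t\<in>?T. ?y t ^ b t)" by (intro prod.cong) (auto simp: b_def)
    finally show ?thesis .
  qed
  then have "(\<Sum>p | p permutes N. \<Prod>j\<in>N. F j (\<beta> (p j))) * (\<Prod>t\<in>?T. ?y t ^ b t)
      = (\<Sum>p | p permutes N. ?g (\<beta> \<circ> p))"
    unfolding sum_distrib_right by (intro sum.cong refl) (simp only: prod.distrib o_def mem_Collect_eq)
  also have "\<dots> = (\<Sum>p | p permutes N. ?g (?r p))"
    by (intro sum.cong prod.cong refl) auto
  \<comment> \<open>Permutations are grouped by the colour pattern that they produce; each pattern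
    occurs at most \<open>?M\<close> times.\<close>
  also have "\<dots> = (\<Sum>c\<in>?r ` {p. p permutes N}. \<Sum>p | p permutes N \<and> ?r p = c. ?g (?r p))"
    using sum.image_gen[OF fin, of "\<lambda>p. ?g (?r p)" ?r] by simp
  also have "\<dots> = (\<Sum>c\<in>?r ` {p. p permutes N}. card {p. p permutes N \<and> ?r p = c} * ?g c)"
    by (intro sum.cong) auto
  also have "\<dots> \<le> (\<Sum>c\<in>?r ` {p. p permutes N}. ?M * ?g c)"
  proof (intro sum_mono mult_right_mono)
    fix c assume "c \<in> ?r ` {p. p permutes N}"
    then have ext: "c \<in> extensional N" by auto
    have "{p. p permutes N \<and> ?r p = c} = {p. p permutes N \<and> (\<forall>j\<in>N. \<beta> (p j) = c j)}"
      using ext by (auto simp: fun_eq_iff restrict_def extensional_def)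
    then have "card {p. p permutes N \<and> ?r p = c} \<le> (\<Prod>t\<in>?T. fact (b t))"
      using card_perms_recolour_le[OF N(1), of \<beta> c] by (simp add: b_def)
    then show "real (card {p. p permutes N \<and> ?r p = c}) \<le> ?M"
      by (metis (mono_tags, lifting) of_nat_le_iff of_nat_prod of_nat_fact prod.cong)
  qed (use F n in \<open>auto intro!: prod_nonneg\<close>)
  also have "\<dots> = ?M * (\<Sum>c\<in>?r ` {p. p permutes N}. ?g c)"
    by (simp add: sum_distrib_left)
  \<comment> \<open>Patterns with wrong colour frequencies, that is, the other monomials of the
    polynomial, are added. They are nonnegative, and the full sum factors over
    \<open>j\<close>.\<close>
  also have "\<dots> \<le> ?M * (\<Sum>c\<in>PiE N (\<lambda>_. ?T). ?g c)"
    using N F n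
    by (intro mult_left_mono sum_mono2 finite_PiE)
       (auto intro!: prod_nonneg simp: permutes_in_image)
  also have "(\<Sum>c\<in>PiE N (\<lambda>_. ?T). ?g c) = (\<Prod>j\<in>N. \<Sum>t\<in>?T. F j t * ?y t)"
    using N by (intro prod_sum_PiE[symmetric]) auto
  finally show ?thesis .
qed

text \<open>The values b t / n sum to 1, so each row factor is 1 plus an average of
  \<open>F - 1\<close>, at most its exponential. Stirling from above for every b t! and from below
  for n! cancels all powers and exponentials because the class sizes sum to n; only the square roots
  and the factors e survive.\<close>

lemma sum_perms_prod_le_exp:
  fixes F :: "'a \<Rightarrow> 't \<Rightarrow> real" and \<beta> :: "'a \<Rightarrow> 't"
  assumes N: "finite N" "N \<noteq> {}" and F: "\<And>j t. 0 \<le> F j t"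
  defines "n \<equiv> card N" and "b \<equiv> \<lambda>t. card {j\<in>N. \<beta> j = t}"
  shows "(\<Sum>p | p permutes N. \<Prod>j\<in>N. F j (\<beta> (p j)))
       \<le> fact n * ((\<Prod>t\<in>\<beta> ` N. exp 1 * sqrt (b t)) / sqrt n) *
         exp (\<Sum>j\<in>N. \<Sum>j'\<in>N. (F j (\<beta> j') - 1) / n)"
proof -
  let ?T = "\<beta> ` N"
  let ?S = "\<Sum>p | p permutes N. \<Prod>j\<in>N. F j (\<beta> (p j))"
  let ?E = "exp (\<Sum>j\<in>N. \<Sum>j'\<in>N. (F j (\<beta> j') - 1) / n)"
  let ?Y = "\<Prod>t\<in>?T. real (b t) ^ b t"
  have n: "1 \<le> n" using N by (simp add: n_def Suc_le_eq card_gt_0_iff)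
  have b: "1 \<le> b t" if "t \<in> ?T" for t
    using that N by (auto simp: b_def Suc_le_eq card_gt_0_iff)
  have sb: "(\<Sum>t\<in>?T. b t) = n"
    using sum.image_gen[OF N(1), of "\<lambda>_. 1::nat" \<beta>] by (simp add: n_def b_def)
  have Y: "?Y > 0" using b by (intro prod_pos) (auto simp: Suc_le_eq)
  have colsum: "(\<Sum>t\<in>?T. F j t * (b t / n)) = (\<Sum>j'\<in>N. F j (\<beta> j') / n)" for j
  proof -
    have "(\<Sum>j'\<in>N. F j (\<beta> j') / n) = (\<Sum>t\<in>?T. \<Sum>j' | j' \<in> N \<and> \<beta> j' = t. F j (\<beta> j') / n)"
      by (rule sum.image_gen[OF N(1)])
    also have "\<dots> = (\<Sum>t\<in>?T. F j t * (b t / n))"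
      by (intro sum.cong) (auto simp: b_def)
    finally show ?thesis by simp
  qed
  have 1: "(\<Prod>t\<in>?T. (b t / n) ^ b t) = ?Y / n ^ n"
    by (simp add: power_divide prod_dividef power_sum[symmetric] sb)
  have 2: "(\<Prod>j\<in>N. \<Sum>t\<in>?T. F j t * (b t / n)) \<le> ?E"
  proof -
    have "(\<Prod>j\<in>N. \<Sum>j'\<in>N. F j (\<beta> j') / n) \<le> (\<Prod>j\<in>N. exp (\<Sum>j'\<in>N. (F j (\<beta> j') - 1) / n))"
    proof (intro prod_mono conjI)
      fix j
      have "(\<Sum>j'\<in>N. F j (\<beta> j') / n) = 1 + (\<Sum>j'\<in>N. (F j (\<beta> j') - 1) / n)"
        using n by (simp add: diff_divide_distrib sum_subtractf n_def)
      then show "(\<Sum>j'\<in>N. F j (\<beta> j') / n) \<le> exp (\<Sum>j'\<in>N. (F j (\<beta> j') - 1) / n)"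
        by (simp add: exp_ge_add_one_self)
    qed (auto intro!: sum_nonneg divide_nonneg_nonneg F)
    also have "\<dots> = ?E" using N by (simp add: exp_sum)
    finally show ?thesis by (simp only: colsum)
  qed
  have 3: "(\<Prod>t\<in>?T. fact (b t)) \<le> (\<Prod>t\<in>?T. exp 1 * sqrt (b t)) * (?Y * exp (- real n))"
  proof -
    have "(\<Prod>t\<in>?T. fact (b t)) \<le> (\<Prod>t\<in>?T. exp 1 * sqrt (b t) * (real (b t) ^ b t * exp (- real (b t))))"
      using b by (intro prod_mono conjI fact_le_stirling) auto
    also have "\<dots> = (\<Prod>t\<in>?T. exp 1 * sqrt (b t)) * (?Y * exp (- real n))"
      using N by (simp add: prod.distrib exp_sum[symmetric] sum_negf sb[symmetric])
    finally show ?thesis .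
  qed
  have "?S * (?Y / n ^ n) \<le> (\<Prod>t\<in>?T. fact (b t)) * (\<Prod>j\<in>N. \<Sum>t\<in>?T. F j t * (b t / n))"
    using sum_perms_prod_le[where \<beta> = \<beta> and F = F, OF N F] 
    by (simp only: 1[symmetric, unfolded b_def n_def] b_def n_def)
  also have "\<dots> \<le> (\<Prod>t\<in>?T. exp 1 * sqrt (b t)) * (?Y * exp (- real n)) * ?E"
    by (intro mult_mono 2 3 mult_nonneg_nonneg prod_nonneg ballI sum_nonneg F) auto
  finally have "?S / n ^ n * ?Y \<le> (\<Prod>t\<in>?T. exp 1 * sqrt (b t)) * exp (- real n) * ?E * ?Y"
    by (simp add: mult_ac)
  then have "?S / n ^ n \<le> (\<Prod>t\<in>?T. exp 1 * sqrt (b t)) * exp (- real n) * ?E"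
    using Y by (rule mult_right_le_imp_le)
  then have "?S \<le> (\<Prod>t\<in>?T. exp 1 * sqrt (b t)) * exp (- real n) * ?E * n ^ n"
    using n by (simp add: divide_le_eq)
  also have "\<dots> = (\<Prod>t\<in>?T. exp 1 * sqrt (b t)) / sqrt n * ?E * (sqrt n * (real n ^ n * exp (- real n)))"
    using n by (simp add: field_simps)
  also have "\<dots> \<le> (\<Prod>t\<in>?T. exp 1 * sqrt (b t)) / sqrt n * ?E * fact n"
    using n by (intro mult_left_mono fact_ge_stirling mult_nonneg_nonneg divide_nonneg_nonneg prod_nonneg) auto
  finally show ?thesis by (simp add: mult_ac)
qed

text \<open>The joint exponential moment bound for the edge counts between the classes of two fibres;
  \<open>f\<close> is the exponential of the tilting parameter.\<close>

lemma card_perms_table_le: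
  fixes A :: "'k \<Rightarrow> 'a set" and B :: "'l \<Rightarrow> 'a set" and f :: "'k \<Rightarrow> 'l \<Rightarrow> real"
  assumes N: "finite N" "N \<noteq> {}"
    and A: "\<And>k. k \<in> I \<Longrightarrow> A k \<subseteq> N" "disjoint_family_on A I"
    and B: "\<And>l. l \<in> J \<Longrightarrow> B l \<subseteq> N" "\<And>l. l \<in> J \<Longrightarrow> B l \<noteq> {}" "disjoint_family_on B J"
    and IJ: "finite I" "finite J" and R: "R \<subseteq> I \<times> J"
    and f: "\<And>k l. 0 \<le> f k l"
  shows "card {p. p permutes N \<and> (\<forall>(k, l)\<in>R. card {j\<in>A k. p j \<in> B l} = e k l)} *
           (\<Prod>(k, l)\<in>R. f k l ^ e k l)
       \<le> fact (card N) * exp 1 ^ Suc (card J) * sqrt (\<Prod>l\<in>J. card (B l)) *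
         exp (\<Sum>(k, l)\<in>R. (f k l - 1) * card (A k) * card (B l) / card N)"
proof -
  let ?n = "card N"
  let ?P = "{p. p permutes N \<and> (\<forall>(k, l)\<in>R. card {j\<in>A k. p j \<in> B l} = e k l)}"
  have n: "?n > 0" using N by (simp add: card_gt_0_iff)
  have R': "finite R" using R IJ by (meson finite_SigmaI finite_subset)
  have "\<forall>j. \<exists>t. \<forall>l\<in>J. t = Some l \<longleftrightarrow> j \<in> B l"
  proof
    fix j show "\<exists>t. \<forall>l\<in>J. t = Some l \<longleftrightarrow> j \<in> B l"
    proof (cases "\<exists>l\<in>J. j \<in> B l")
      case True
      then obtain l where l: "l \<in> J" "j \<in> B l" by blast
      then show ?thesis using B(3) by (intro exI[of _ "Some l"]) (auto simp: disjoint_family_on_def)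
    next
      case False
      then show ?thesis by (intro exI[of _ None]) auto
    qed
  qed
  then obtain \<beta>0 where \<beta>0: "\<And>j l. l \<in> J \<Longrightarrow> \<beta>0 j = Some l \<longleftrightarrow> j \<in> B l" by metis
  \<comment> \<open>Points outside every \<open>B l\<close> get the single colour
    \<open>None\<close>; \<open>\<beta>0\<close> may give them stray colours \<open>Some l\<close>
    with \<open>l\<close> outside \<open>J\<close>, which would create further classes.\<close>
  define \<beta> where "\<beta> j = (if \<exists>l\<in>J. j \<in> B l then \<beta>0 j else None)" for j
  have \<beta>: "\<beta> j = Some l \<longleftrightarrow> j \<in> B l" if "l \<in> J" for j l
    using \<beta>0 that by (auto simp: \<beta>_def)
  have \<beta>T: "\<beta> j = None \<or> (\<exists>l\<in>J. \<beta> j = Some l)" for j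
    using \<beta>0 by (auto simp: \<beta>_def)
  define F where "F j t = (\<Prod>(k, l)\<in>R. if j \<in> A k \<and> t = Some l then f k l else 1)" for j t
  have F0: "0 \<le> F j t" for j t
    unfolding F_def by (intro prod_nonneg) (auto simp: f)
  have prodF: "(\<Prod>j\<in>N. F j (\<beta> (p j))) = (\<Prod>(k, l)\<in>R. f k l ^ card {j\<in>A k. p j \<in> B l})" for p
  proof -
    have "(\<Prod>j\<in>N. F j (\<beta> (p j))) =
        (\<Prod>x\<in>R. \<Prod>j\<in>N. case x of (k, l) \<Rightarrow> if j \<in> A k \<and> \<beta> (p j) = Some l then f k l else 1)"
      unfolding F_def by (rule prod.swap)
    also have "\<dots> = (\<Prod>(k, l)\<in>R. f k l ^ card {j\<in>A k. p j \<in> B l})"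
    proof (intro prod.cong refl, clarify)
      fix k l assume kl: "(k, l) \<in> R"
      then have "{j\<in>N. j \<in> A k \<and> \<beta> (p j) = Some l} = {j\<in>A k. p j \<in> B l}"
        using R A(1) \<beta> by auto
      then show "(\<Prod>j\<in>N. if j \<in> A k \<and> \<beta> (p j) = Some l then f k l else 1) =
          f k l ^ card {j\<in>A k. p j \<in> B l}"
        using N(1) by (simp add: prod.If_cases Int_def)
    qed
    finally show ?thesis .
  qed
  \<comment> \<open>The sets \<open>A k\<close> are disjoint and \<open>t\<close> names at most one
    \<open>l\<close>, so at most one factor of \<open>F j t\<close> differs from 1. This turns the
    product into a sum and makes the exponent additive over \<open>R\<close>.\<close>
  have F1: "F j t - 1 = (\<Sum>(k, l)\<in>R. if j \<in> A k \<and> t = Some l then f k l - 1 else 0)" for j t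
  proof (cases "\<exists>k l. (k, l) \<in> R \<and> j \<in> A k \<and> t = Some l")
    case True
    then obtain k l where kl: "(k, l) \<in> R" "j \<in> A k" "t = Some l" by blast
    have other: "\<not> (j \<in> A k' \<and> t = Some l')" if "(k', l') \<in> R - {(k, l)}" for k' l'
      using that kl R A(2) by (auto simp: disjoint_family_on_def)
    have "(\<Prod>(k, l)\<in>R - {(k, l)}. if j \<in> A k \<and> t = Some l then f k l else 1) = 1"
      by (rule prod.neutral) (use other in fastforce)
    then have "F j t = f k l"
      unfolding F_def using R' kl by (subst prod.remove[of R "(k, l)"]) auto
    moreover have "(\<Sum>(k, l)\<in>R - {(k, l)}. if j \<in> A k \<and> t = Some l then f k l - 1 else 0) = 0"
      by (rule sum.neutral) (use other in fastforce)
    then have "(\<Sum>(k, l)\<in>R. if j \<in> A k \<and> t = Some l then f k l - 1 else 0) = f k l - 1"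
      using R' kl by (subst sum.remove[of R "(k, l)"]) auto
    ultimately show ?thesis by simp
  next
    case False
    then have "F j t = 1" unfolding F_def by (intro prod.neutral) auto
    moreover have "(\<Sum>(k, l)\<in>R. if j \<in> A k \<and> t = Some l then f k l - 1 else 0) = 0"
      using False by (intro sum.neutral) auto
    ultimately show ?thesis by simp
  qed
  have sumF: "(\<Sum>j\<in>N. \<Sum>j'\<in>N. (F j (\<beta> j') - 1) / ?n) =
      (\<Sum>(k, l)\<in>R. (f k l - 1) * card (A k) * card (B l) / ?n)"
  proof -
    have "(\<Sum>j\<in>N. \<Sum>j'\<in>N. F j (\<beta> j') - 1) =
       (\<Sum>x\<in>R. \<Sum>j\<in>N. \<Sum>j'\<in>N. case x of (k, l) \<Rightarrow> if j \<in> A k \<and> \<beta> j' = Some l then f k l - 1 else 0)"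
      unfolding F1 by (subst (2) sum.swap, subst sum.swap) simp
    also have "\<dots> = (\<Sum>(k, l)\<in>R. (f k l - 1) * card (A k) * card (B l))"
    proof (intro sum.cong refl, clarify)
      fix k l assume kl: "(k, l) \<in> R"
      then have "k \<in> I" "l \<in> J" using R by auto
      then have eq: "{j\<in>N. j \<in> A k} = A k" "{j\<in>N. \<beta> j = Some l} = B l"
        using A(1)[of k] B(1)[of l] \<beta>[of l] by auto
      have "(\<Sum>j\<in>N. \<Sum>j'\<in>N. if j \<in> A k \<and> \<beta> j' = Some l then f k l - 1 else 0) =
            (\<Sum>j\<in>N. if j \<in> A k then (\<Sum>j'\<in>N. if \<beta> j' = Some l then f k l - 1 else 0) else 0)"
        by (intro sum.cong) auto
      also have "\<dots> = card (A k) * (card (B l) * (f k l - 1))"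
        using N(1) eq by (simp add: sum.If_cases Int_def)
      finally show "(\<Sum>j\<in>N. \<Sum>j'\<in>N. if j \<in> A k \<and> \<beta> j' = Some l then f k l - 1 else 0) =
          (f k l - 1) * card (A k) * card (B l)" by (simp add: mult_ac)
    qed
    finally show ?thesis
      by (simp add: sum_divide_distrib[symmetric] split_def)
  qed
  \<comment> \<open>Markov's inequality in counting form: on \<open>?P\<close> the weight is
    constant, and dropping the restriction to \<open>?P\<close> adds nonnegative terms.\<close>
  have "card ?P * (\<Prod>(k, l)\<in>R. f k l ^ e k l) =
        (\<Sum>p\<in>?P. \<Prod>(k, l)\<in>R. f k l ^ card {j\<in>A k. p j \<in> B l})"
  proof -
    have "(\<Prod>(k, l)\<in>R. f k l ^ card {j\<in>A k. p j \<in> B l}) = (\<Prod>(k, l)\<in>R. f k l ^ e k l)"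
      if "p \<in> ?P" for p
      using that by (intro prod.cong) auto
    then show ?thesis by simp
  qed
  also have "\<dots> \<le> (\<Sum>p | p permutes N. \<Prod>(k, l)\<in>R. f k l ^ card {j\<in>A k. p j \<in> B l})"
    using N by (intro sum_mono2) (auto simp: finite_permutations f intro!: prod_nonneg)
  also have "\<dots> \<le> fact ?n * ((\<Prod>t\<in>\<beta> ` N. exp 1 * sqrt (card {j\<in>N. \<beta> j = t})) / sqrt ?n) *
      exp (\<Sum>(k, l)\<in>R. (f k l - 1) * card (A k) * card (B l) / ?n)"
    using sum_perms_prod_le_exp[of N F \<beta>, OF N F0] by (simp only: prodF sumF)
  also have "\<dots> \<le> fact ?n * (exp 1 ^ Suc (card J) * sqrt (\<Prod>l\<in>J. card (B l))) *
      exp (\<Sum>(k, l)\<in>R. (f k l - 1) * card (A k) * card (B l) / ?n)"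
  proof (intro mult_right_mono mult_left_mono)
    \<comment> \<open>The leftover class \<open>None\<close> is bounded by the whole fibre; its
      \<open>sqrt ?n\<close> cancels the division by \<open>sqrt ?n\<close>, and its factor e
      explains \<open>Suc (card J)\<close>.\<close>
    let ?h = "\<lambda>t. exp 1 * (if t = None then sqrt ?n else sqrt (card {j\<in>N. \<beta> j = t}))"
    have bl: "{j\<in>N. \<beta> j = Some l} = B l" if "l \<in> J" for l
      using B(1) \<beta> that by auto
    have b1: "1 \<le> card (B l)" if "l \<in> J" for l
      using B(1,2)[OF that] N(1) by (auto simp: Suc_le_eq card_gt_0_iff intro: finite_subset)
    have "(\<Prod>t\<in>\<beta> ` N. exp 1 * sqrt (card {j\<in>N. \<beta> j = t})) \<le> (\<Prod>t\<in>\<beta> ` N. ?h t)"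
      using N by (intro prod_mono) (auto intro!: card_mono)
    also have "\<dots> \<le> (\<Prod>t\<in>insert None (Some ` J). ?h t)"
    proof (rule prod_mono2)
      fix t assume "t \<in> insert None (Some ` J) - \<beta> ` N"
      then have "1 \<le> (if t = None then sqrt ?n else sqrt (card {j\<in>N. \<beta> j = t}))"
        using b1 bl n by (auto simp: Suc_le_eq)
      then have "1 * 1 \<le> ?h t" by (intro mult_mono) auto
      then show "1 \<le> ?h t" by simp
    next
      show "\<beta> ` N \<subseteq> insert None (Some ` J)" using \<beta>T by force
    qed (use IJ in auto)
    also have "\<dots> = exp 1 * sqrt ?n * (\<Prod>l\<in>J. exp 1 * sqrt (card (B l)))"
      using IJ bl by (subst prod.insert) (auto simp: prod.reindex)
    also have "\<dots> = exp 1 ^ Suc (card J) * sqrt (\<Prod>l\<in>J. card (B l)) * sqrt ?n"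
      by (simp add: prod.distrib sqrt_prod[symmetric])
    finally show "(\<Prod>t\<in>\<beta> ` N. exp 1 * sqrt (card {j\<in>N. \<beta> j = t})) / sqrt ?n
        \<le> exp 1 ^ Suc (card J) * sqrt (\<Prod>l\<in>J. card (B l))"
      using n by (simp add: divide_le_eq)
  qed auto
  finally show ?thesis by (simp add: mult_ac)
qed

lemma prod_power_eq_exp:
  assumes "finite R" "\<And>k l. (k, l) \<in> R \<Longrightarrow> 0 < m k l"
  shows "(\<Prod>(k, l)\<in>R. (real (e k l) / m k l) ^ e k l) =
    exp (\<Sum>(k, l)\<in>R. real (e k l) * ln (real (e k l) / m k l))"
proof -
  have "(real (e k l) / m k l) ^ e k l = exp (real (e k l) * ln (real (e k l) / m k l))"
    if "(k, l) \<in> R" for k l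
    using assms(2)[OF that] by (cases "e k l = 0") (auto simp: exp_of_nat_mult)
  then show ?thesis using assms(1) by (simp add: exp_sum split_def)
qed

text \<open>The optimal tilt \<open>f = e / m\<close> in the exponential moment bound. Where
  \<open>e\<close> is 0 the tilt is 0 as well, and 0^0 = 1 keeps the formula valid.\<close>

lemma card_perms_table_le_rel_dev:
  fixes A :: "'k \<Rightarrow> 'a set" and B :: "'l \<Rightarrow> 'a set"
  assumes N: "finite N" "N \<noteq> {}"
    and A: "\<And>k. k \<in> I \<Longrightarrow> A k \<subseteq> N" "\<And>k. k \<in> I \<Longrightarrow> A k \<noteq> {}" "disjoint_family_on A I"
    and B: "\<And>l. l \<in> J \<Longrightarrow> B l \<subseteq> N" "\<And>l. l \<in> J \<Longrightarrow> B l \<noteq> {}" "disjoint_family_on B J"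
    and IJ: "finite I" "finite J" and R: "R \<subseteq> I \<times> J"
  shows "card {p. p permutes N \<and> (\<forall>(k, l)\<in>R. card {j\<in>A k. p j \<in> B l} = e k l)}
       \<le> fact (card N) * exp 1 ^ Suc (card J) * sqrt (\<Prod>l\<in>J. card (B l)) *
         exp (- (\<Sum>(k, l)\<in>R. rel_dev (e k l) (card (A k) * card (B l) / card N)))"
proof -
  let ?P = "{p. p permutes N \<and> (\<forall>(k, l)\<in>R. card {j\<in>A k. p j \<in> B l} = e k l)}"
  let ?Q = "fact (card N) * exp 1 ^ Suc (card J) * sqrt (\<Prod>l\<in>J. card (B l))"
  define m where "m k l = card (A k) * card (B l) / card N" for k l
  have R': "finite R" using R IJ by (meson finite_SigmaI finite_subset)
  have m: "0 < m k l" if "(k, l) \<in> R" for k l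
  proof -
    have "k \<in> I" "l \<in> J" using that R by auto
    then have "0 < card (A k)" "0 < card (B l)"
      using A(1,2) B(1,2) N(1) by (meson card_gt_0_iff finite_subset)+
    then show ?thesis using N by (simp add: m_def card_gt_0_iff)
  qed
  have m0: "0 \<le> m k l" for k l by (simp add: m_def)
  let ?X = "\<Sum>(k, l)\<in>R. real (e k l) * ln (real (e k l) / m k l)"
  have "card ?P * exp ?X = card ?P * (\<Prod>(k, l)\<in>R. (real (e k l) / m k l) ^ e k l)"
    by (simp only: prod_power_eq_exp[OF R' m])
  also have "\<dots> \<le> ?Q * exp (\<Sum>(k, l)\<in>R. (real (e k l) / m k l - 1) * card (A k) * card (B l) / card N)"
    by (rule card_perms_table_le[OF N A(1,3) B IJ R]) (simp_all add: m0)
  also have "(\<Sum>(k, l)\<in>R. (real (e k l) / m k l - 1) * card (A k) * card (B l) / card N) =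
      (\<Sum>(k, l)\<in>R. real (e k l) - m k l)"
  proof (intro sum.cong refl, clarify)
    fix k l assume "(k, l) \<in> R"
    have "(real (e k l) / m k l - 1) * card (A k) * card (B l) / card N = (real (e k l) / m k l - 1) * m k l"
      by (simp add: m_def)
    also have "\<dots> = real (e k l) - m k l" using m[OF \<open>(k, l) \<in> R\<close>] by (simp add: field_simps)
    finally show "(real (e k l) / m k l - 1) * card (A k) * card (B l) / card N = real (e k l) - m k l" .
  qed
  finally have "card ?P * exp ?X * exp (- ?X) \<le> ?Q * exp (\<Sum>(k, l)\<in>R. real (e k l) - m k l) * exp (- ?X)"
    by (rule mult_right_mono) simp
  also have "\<dots> = ?Q * exp (- (\<Sum>(k, l)\<in>R. rel_dev (e k l) (m k l)))"
    by (simp add: exp_add[symmetric] rel_dev_def sum_subtractf sum.distrib split_def)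
  also have "card ?P * exp ?X * exp (- ?X) = card ?P"
    by (simp only: mult.assoc exp_add[symmetric] add.right_inverse exp_zero mult_1_right)
  finally show ?thesis by (simp only: m_def)
qed

text \<open>Exchanging the roles of the two fibres and taking the geometric mean of the two bounds
  halves the polynomial loss on each side.\<close>

lemma card_perms_table_le_rel_dev_sym:
  fixes A :: "'k \<Rightarrow> 'a set" and B :: "'l \<Rightarrow> 'a set"
  assumes N: "finite N" "N \<noteq> {}"
    and A: "\<And>k. k \<in> I \<Longrightarrow> A k \<subseteq> N" "\<And>k. k \<in> I \<Longrightarrow> A k \<noteq> {}" "disjoint_family_on A I"
    and B: "\<And>l. l \<in> J \<Longrightarrow> B l \<subseteq> N" "\<And>l. l \<in> J \<Longrightarrow> B l \<noteq> {}" "disjoint_family_on B J"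
    and IJ: "finite I" "finite J" "card I \<le> s" "card J \<le> s" and R: "R \<subseteq> I \<times> J"
  shows "card {p. p permutes N \<and> (\<forall>(k, l)\<in>R. card {j\<in>A k. p j \<in> B l} = e k l)}
       \<le> fact (card N) * exp 1 ^ Suc s *
         (\<Prod>k\<in>I. real (card (A k)) powr (1/4)) * (\<Prod>l\<in>J. real (card (B l)) powr (1/4)) *
         exp (- (\<Sum>(k, l)\<in>R. rel_dev (e k l) (card (A k) * card (B l) / card N)))"
proof -
  let ?P = "{p. p permutes N \<and> (\<forall>(k, l)\<in>R. card {j\<in>A k. p j \<in> B l} = e k l)}"
  let ?P' = "{p. p permutes N \<and> (\<forall>(l, k)\<in>R\<inverse>. card {j\<in>B l. p j \<in> A k} = e k l)}"
  let ?D = "\<Sum>(k, l)\<in>R. rel_dev (e k l) (card (A k) * card (B l) / card N)"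
  let ?K = "fact (card N) * exp 1 ^ Suc s * exp (- ?D)"
  let ?a = "\<Prod>k\<in>I. real (card (A k))" and ?b = "\<Prod>l\<in>J. real (card (B l))"
  have R': "R\<inverse> \<subseteq> J \<times> I" using R by auto
  \<comment> \<open>Passing to inverse permutations exchanges the two fibres, so the square roots
    fall on the classes \<open>A k\<close> instead.\<close>
  have "card ?P \<le> card ?P'"
  proof (rule card_inj_on_le)
    show "inj_on inv ?P" by (rule inj_on_subset[OF inv_inj_on_permutes]) auto
    show "finite ?P'" using finite_permutations[OF N(1)] by (rule finite_subset[rotated]) auto
    show "inv ` ?P \<subseteq> ?P'"
    proof (rule image_subsetI, clarsimp, rule conjI)
      fix p assume p: "p permutes N" and e: "\<forall>(k, l)\<in>R. card {j \<in> A k. p j \<in> B l} = e k l"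
      show "inv p permutes N" using p by (rule permutes_inv)
      show "\<forall>(l, k)\<in>R\<inverse>. card {j \<in> B l. inv p j \<in> A k} = e k l"
      proof clarsimp
        fix l k assume kl: "(k, l) \<in> R"
        have "bij_betw p {j \<in> A k. p j \<in> B l} {j \<in> B l. inv p j \<in> A k}"
          by (rule bij_betwI[of _ _ _ "inv p"]) (auto simp: permutes_inverses[OF p])
        then show "card {j \<in> B l. inv p j \<in> A k} = e k l"
          using e kl bij_betw_same_card by fastforce
      qed
    qed
  qed
  also have "card ?P' \<le> fact (card N) * exp 1 ^ Suc (card I) * sqrt ?a *
      exp (- (\<Sum>(l, k)\<in>R\<inverse>. rel_dev (e k l) (card (B l) * card (A k) / card N)))"
    using card_perms_table_le_rel_dev[OF N B A IJ(2,1) R', of "\<lambda>l k. e k l"]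
    by (simp only: of_nat_prod)
  also have "(\<Sum>(l, k)\<in>R\<inverse>. rel_dev (e k l) (card (B l) * card (A k) / card N)) = ?D"
    by (rule sum.reindex_bij_witness[of _ prod.swap prod.swap]) (auto simp: mult.commute)
  also have "fact (card N) * exp 1 ^ Suc (card I) * sqrt ?a * exp (- ?D) \<le>
     fact (card N) * exp 1 ^ Suc s * sqrt ?a * exp (- ?D)"
    using IJ by (intro mult_right_mono mult_left_mono power_increasing) (auto intro!: prod_nonneg)
  finally have 1: "card ?P \<le> ?K * sqrt ?a" by (simp add: mult_ac)
  have "card ?P \<le> fact (card N) * exp 1 ^ Suc (card J) * sqrt ?b * exp (- ?D)"
    using card_perms_table_le_rel_dev[OF N A B IJ(1,2) R, of e] by simp
  also have "\<dots> \<le> fact (card N) * exp 1 ^ Suc s * sqrt ?b * exp (- ?D)"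
    using IJ by (intro mult_right_mono mult_left_mono power_increasing) (auto intro!: prod_nonneg)
  finally have 2: "card ?P \<le> ?K * sqrt ?b" by (simp add: mult_ac)
  have "real (card ?P) \<le> ?K * (sqrt (sqrt ?a) * sqrt (sqrt ?b))"
    by (rule le_geometric_mean[OF _ 1 2]) (auto intro!: prod_nonneg)
  also have "sqrt (sqrt ?a) = (\<Prod>k\<in>I. real (card (A k)) powr (1/4))"
    by (simp add: sqrt_prod powr_half_sqrt[symmetric] powr_powr)
  also have "sqrt (sqrt ?b) = (\<Prod>l\<in>J. real (card (B l)) powr (1/4))"
    by (simp add: sqrt_prod powr_half_sqrt[symmetric] powr_powr)
  finally show ?thesis by (simp add: mult_ac)
qed

section \<open>Greedy deletion and geometric sums\<close>

text \<open>Vertices whose total deviation falls below their threshold \<open>b\<close> are deleted one after the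
  other; \<open>Q\<close> records each lost pair at the endpoint deleted first.\<close>

lemma greedy_deletion:
  fixes D :: "'v \<Rightarrow> 'v \<Rightarrow> real"
  assumes "finite V" "\<And>v. v \<in> V \<Longrightarrow> 0 \<le> b v"
  shows "\<exists>S Q. S \<subseteq> V \<and> Q \<subseteq> V \<times> V \<and> (\<forall>v\<in>V. (\<Sum>u | (v, u) \<in> Q. D v u) \<le> b v) \<and>
           (\<forall>v\<in>V. \<forall>u\<in>V. v \<in> S \<and> u \<in> S \<or> (v, u) \<in> Q \<or> (u, v) \<in> Q) \<and>
           (\<Sum>v\<in>S. b v) \<le> (\<Sum>v\<in>S. \<Sum>u\<in>S. D v u)"
  using assms
proof (induction V rule: finite_psubset_induct)
  case (psubset V)
  show ?case
  proof (cases "\<forall>v\<in>V. b v \<le> (\<Sum>u\<in>V. D v u)")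
    case True
    then show ?thesis using psubset.prems
      by (intro exI[of _ V] exI[of _ "{}"]) (auto intro!: sum_mono)
  next
    case False
    then obtain v where v: "v \<in> V" "(\<Sum>u\<in>V. D v u) \<le> b v" by force
    have "\<exists>S Q. S \<subseteq> V - {v} \<and> Q \<subseteq> (V - {v}) \<times> (V - {v}) \<and>
        (\<forall>x\<in>V - {v}. (\<Sum>u | (x, u) \<in> Q. D x u) \<le> b x) \<and>
        (\<forall>x\<in>V - {v}. \<forall>u\<in>V - {v}. x \<in> S \<and> u \<in> S \<or> (x, u) \<in> Q \<or> (u, x) \<in> Q) \<and>
        (\<Sum>x\<in>S. b x) \<le> (\<Sum>x\<in>S. \<Sum>u\<in>S. D x u)"
      using v psubset.prems by (intro psubset.IH) auto
    then obtain S Q where SQ: "S \<subseteq> V - {v}" "Q \<subseteq> (V - {v}) \<times> (V - {v})"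
        "\<forall>x\<in>V - {v}. (\<Sum>u | (x, u) \<in> Q. D x u) \<le> b x"
        "\<forall>x\<in>V - {v}. \<forall>u\<in>V - {v}. x \<in> S \<and> u \<in> S \<or> (x, u) \<in> Q \<or> (u, x) \<in> Q"
        "(\<Sum>x\<in>S. b x) \<le> (\<Sum>x\<in>S. \<Sum>u\<in>S. D x u)"
      by (elim exE conjE) (rule that)
    \<comment> \<open>Row \<open>v\<close> is the whole vertex set at the time of deletion, so its
      load is exactly the deficient sum. The inductive \<open>Q\<close> avoids \<open>v\<close>,
      hence no other row changes.\<close>
    let ?Q = "Q \<union> {v} \<times> V"
    have "(\<Sum>u | (x, u) \<in> ?Q. D x u) \<le> b x" if "x \<in> V" for x
    proof (cases "x = v")
      case True
      then have "{u. (x, u) \<in> ?Q} = V" using SQ(2) by auto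
      then show ?thesis using v True by simp
    next
      case False
      then have "{u. (x, u) \<in> ?Q} = {u. (x, u) \<in> Q}" by auto
      then show ?thesis using SQ(3) False that by simp
    qed
    moreover have "?Q \<subseteq> V \<times> V" using SQ(2) v by auto
    moreover have "\<forall>x\<in>V. \<forall>u\<in>V. x \<in> S \<and> u \<in> S \<or> (x, u) \<in> ?Q \<or> (u, x) \<in> ?Q"
      using SQ(4) by blast
    ultimately show ?thesis using SQ(1,5) by (intro exI[of _ S] exI[of _ ?Q]) auto
  qed
qed

section \<open>Sums over dyadic scales, bounded by potential functions\<close>

lemma sum_le_telescope:
  fixes f G :: "nat \<Rightarrow> real"
  assumes "finite K" "\<And>k. k \<in> K \<Longrightarrow> f k \<le> G (Suc k) - G k" "\<And>k. G k \<le> G (Suc k)"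
    and "\<And>k. lo \<le> G k" "\<And>k. G k \<le> hi"
  shows "sum f K \<le> hi - lo"
proof -
  obtain m where m: "K \<subseteq> {..<m}" using assms(1) by (meson finite_nat_iff_bounded)
  have "sum f K \<le> (\<Sum>k\<in>K. G (Suc k) - G k)" using assms by (intro sum_mono)
  also have "\<dots> \<le> (\<Sum>k<m. G (Suc k) - G k)"
    using m assms(3) by (intro sum_mono2) auto
  also have "\<dots> = G m - G 0" by (rule sum_lessThan_telescope)
  also have "\<dots> \<le> hi - lo" using assms(4)[of 0] assms(5)[of m] by linarith
  finally show ?thesis .
qed

text \<open>The terms grow geometrically up to the scale 1 and decay geometrically beyond it,
  whatever the position of \<open>r\<close>.\<close>

lemma sum_min_geometric_le:
  fixes r :: real
  assumes "finite K" "0 < r"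
  shows "(\<Sum>k\<in>K. min (2 ^ k * r) (1 / sqrt (2 ^ k * r))) \<le> 6"
proof -
  \<comment> \<open>The part \<open>min u 2\<close> gains u on doubling while u is at most 1. Beyond
    1 the other part gains 4 (1 - 1/sqrt 2) / sqrt u, at least 1 / sqrt u. The range of
    \<open>g\<close> lies between -4 and 2, whence 6.\<close>
  define g where "g u = min u 2 - 4 * min 1 (1 / sqrt u)" for u :: real
  have incr: "min u (1 / sqrt u) \<le> g (2 * u) - g u" if u: "0 < u" for u
  proof (cases "u \<le> 1")
    case True
    have "1 \<le> 1 / sqrt u" using True u by simp
    then have "g u = u - 4" using True by (simp add: g_def)
    moreover have "g (2 * u) \<ge> 2 * u - 4" using True by (simp add: g_def min_def)
    ultimately show ?thesis by linarith
  next
    case False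
    have s: "4/3 \<le> sqrt (2::real)" by (rule real_le_rsqrt) (simp add: power2_eq_square)
    have su: "1 < sqrt u" using False by simp
    have "1 / sqrt (2 * u) = 1 / sqrt 2 * (1 / sqrt u)" by (simp add: real_sqrt_mult)
    also have "\<dots> \<le> 3/4 * (1 / sqrt u)"
      using s su by (intro mult_right_mono) (auto simp: field_simps)
    finally have "4 * min 1 (1 / sqrt (2 * u)) \<le> 3 * (1 / sqrt u)" by linarith
    moreover have "min 1 (1 / sqrt u) = 1 / sqrt u" using su by simp
    moreover have "min u 2 \<le> min (2 * u) 2" using u by auto
    ultimately show ?thesis unfolding g_def by linarith
  qed
  have "(\<Sum>k\<in>K. min (2 ^ k * r) (1 / sqrt (2 ^ k * r))) \<le> 2 - (- 4)"
  proof (rule sum_le_telescope[where G = "\<lambda>k. g (2 ^ k * r)"])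
    fix k
    have u: "0 < 2 ^ k * r" using assms by simp
    show *: "min (2 ^ k * r) (1 / sqrt (2 ^ k * r)) \<le> g (2 ^ Suc k * r) - g (2 ^ k * r)"
      using incr[OF u] by (simp add: mult_ac)
    have "0 \<le> min (2 ^ k * r) (1 / sqrt (2 ^ k * r))" using u by simp
    then show "g (2 ^ k * r) \<le> g (2 ^ Suc k * r)" using * by linarith
    have "0 < 1 / sqrt (2 ^ k * r)" using u by simp
    then show "- 4 \<le> g (2 ^ k * r)" "g (2 ^ k * r) \<le> 2" using u unfolding g_def by linarith+
  qed (use assms in auto)
  then show ?thesis by simp
qed

lemma sum_inverse_geometric_le:
  fixes r :: real
  assumes "finite K" "0 < r" "\<And>k. k \<in> K \<Longrightarrow> 1 < 2 ^ k * r"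
  shows "(\<Sum>k\<in>K. 1 / (2 ^ k * r)) \<le> 2"
proof -
  have "(\<Sum>k\<in>K. 1 / (2 ^ k * r)) \<le> 0 - (- 2)"
  \<comment> \<open>For u = 2^k r above 1, doubling u raises this potential by exactly 1 / u, and
    its total range is 2.\<close>
  proof (rule sum_le_telescope[where G = "\<lambda>k. - 2 * min 1 (1 / (2 ^ k * r))"])
    fix k
    have u: "0 < 2 ^ k * r" using assms by simp
    have u': "0 < 1 / (2 ^ k * r)" using u by simp
    have half: "1 / (2 ^ Suc k * r) = 1 / 2 * (1 / (2 ^ k * r))" by simp
    show "- 2 * min 1 (1 / (2 ^ k * r)) \<le> - 2 * min 1 (1 / (2 ^ Suc k * r))"
      unfolding half using u' by linarith
    show "1 / (2 ^ k * r) \<le> - 2 * min 1 (1 / (2 ^ Suc k * r)) - - 2 * min 1 (1 / (2 ^ k * r))"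
      if "k \<in> K"
    proof -
      have "1 / (2 ^ k * r) < 1" using assms(3)[OF that] by simp
      then show ?thesis unfolding half by linarith
    qed
    show "- 2 \<le> - 2 * min 1 (1 / (2 ^ k * r))" "- 2 * min 1 (1 / (2 ^ k * r)) \<le> 0"
      using u' by linarith+
  qed (use assms in auto)
  then show ?thesis by simp
qed

lemma Cauchy_Schwarz_sqrt_sum:
  fixes f g :: "'b \<Rightarrow> real"
  assumes "\<And>x. x \<in> X \<Longrightarrow> 0 \<le> f x" "\<And>x. x \<in> X \<Longrightarrow> 0 \<le> g x"
  shows "(\<Sum>x\<in>X. sqrt (f x) * sqrt (g x)) \<le> sqrt (sum f X) * sqrt (sum g X)"
proof -
  have "(\<Sum>x\<in>X. sqrt (f x) * sqrt (g x))\<^sup>2 \<le> (\<Sum>x\<in>X. (sqrt (f x))\<^sup>2) * (\<Sum>x\<in>X. (sqrt (g x))\<^sup>2)"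
    by (rule Cauchy_Schwarz_ineq_sum)
  also have "\<dots> = sum f X * sum g X" using assms by simp
  finally show ?thesis unfolding real_sqrt_mult[symmetric] by (rule real_le_rsqrt)
qed

section \<open>The potency lost by deletion\<close>

locale lift_pattern =
  fixes adjH :: "nat \<Rightarrow> nat \<Rightarrow> bool" and d n h :: nat
    and a :: "nat \<times> nat \<Rightarrow> nat" and e :: "nat \<times> nat \<Rightarrow> nat \<times> nat \<Rightarrow> nat"
  assumes d_ge_2: "2 \<le> d" and regular: "regular_graph adjH h d"
    and n_pos: "1 \<le> n" and h_pos: "1 \<le> h" and pattern: "is_pattern adjH d n h a e"
begin

section \<open>Notation and basic facts for a fixed pattern\<close>

definition V :: "(nat \<times> nat) set" where "V = {v. a v \<noteq> 0}"

abbreviation w :: "nat \<times> nat \<Rightarrow> real" where "w v \<equiv> wt n h (snd v)"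

abbreviation adj :: "nat \<times> nat \<Rightarrow> nat \<times> nat \<Rightarrow> bool" where "adj \<equiv> Gamma_adj adjH d n h"

definition mu :: "nat \<times> nat \<Rightarrow> nat \<times> nat \<Rightarrow> real" where "mu v u = real (a v) * real (a u) / real n"

text \<open>The value 0 off the edges of \<open>Gamma\<close> lets the greedy deletion run over all
  pairs of vertices.\<close>

definition dev :: "nat \<times> nat \<Rightarrow> nat \<times> nat \<Rightarrow> real" where
  "dev v u = (if adj v u then rel_dev (e v u) (mu v u) else 0)"

definition levels :: "nat \<Rightarrow> nat set" where "levels i = {k. a (i, k) \<noteq> 0}"

text \<open>Truncating at \<open>n div 2\<close> makes this the price of choosing a class (an upper
  bound for the logarithm of n choose a), also for classes larger than half a fibre.\<close>

definition logbinom :: "nat \<times> nat \<Rightarrow> real" where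
  "logbinom v = ln (real (n choose min (a v) (n div 2)))"

definition mass :: "nat \<Rightarrow> real" where
  "mass i = (\<Sum>k\<in>levels i. (wt n h k)\<^sup>2 * real (a (i, k)))"

lemma wt_pos: "0 < wt n h k"
  using n_pos h_pos by (simp add: wt_def)

lemma wt_eq: "wt n h k = 2 ^ k * wt n h 0"
  by (simp add: wt_def)

lemma wt_ratio: "wt n h k / wt n h l = 2 ^ k / 2 ^ l"
  using n_pos h_pos by (simp add: wt_def)

lemma adj_sym: "adj v u \<longleftrightarrow> adj u v"
proof -
  have "adj u v" if "adj v u" for u v
  proof -
    have "0 < w v" "0 < w u" "0 < sqrt (real d)" using wt_pos d_ge_2 by auto
    moreover have "1 / sqrt d < w v / w u" "w v / w u < sqrt d" using that by (auto simp: Gamma_adj_def)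
    ultimately have "w u / w v < sqrt d" "1 / sqrt d < w u / w v" by (simp_all add: field_simps)
    then show ?thesis using that regular by (auto simp: Gamma_adj_def regular_graph_def)
  qed
  then show ?thesis by blast
qed

lemma V_fst: "v \<in> V \<Longrightarrow> fst v < h"
  using pattern unfolding is_pattern_def V_def by (meson mem_Collect_eq not_le_imp_less)

lemma e_sym: "adj v u \<Longrightarrow> e v u = e u v"
  using pattern unfolding is_pattern_def by blast

lemma e_le: "adj v u \<Longrightarrow> e v u \<le> min (a v) (a u)"
  using pattern unfolding is_pattern_def by blast

text \<open>A dyadic ratio 2^j at most \<open>d\<close> forces j < d since 2^j > j. The bound is
  crude, but free of \<open>n\<close>, as the constant \<open>C\<close> requires.\<close>

lemma ex_level_window: "\<exists>k0. \<forall>v\<in>V. snd v \<in> {k0..<k0 + d}"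
proof -
  obtain k0 where k0: "\<And>v. a v \<noteq> 0 \<Longrightarrow> wt n h k0 \<le> w v \<and> w v \<le> real d * wt n h k0"
    using pattern unfolding is_pattern_def by blast
  have "snd v \<in> {k0..<k0 + d}" if "v \<in> V" for v
  proof -
    have *: "wt n h k0 \<le> w v" "w v \<le> real d * wt n h k0" using k0 that by (auto simp: V_def)
    have "(2::real) ^ k0 \<le> 2 ^ snd v"
      using *(1) wt_pos[of 0] by (simp add: wt_eq[of k0] wt_eq[of "snd v"])
    then have ge: "k0 \<le> snd v" by (simp add: power_increasing_iff)
    have "(2::real) ^ snd v \<le> real d * 2 ^ k0"
      using *(2) wt_pos[of 0] by (simp add: wt_eq[of k0] wt_eq[of "snd v"])
    then have "(2::real) ^ (snd v - k0) * 2 ^ k0 \<le> real d * 2 ^ k0"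
      using ge by (simp add: power_add[symmetric])
    then have "(2::real) ^ (snd v - k0) \<le> real d" by simp
    then have "2 ^ (snd v - k0) \<le> d" by (metis of_nat_le_iff of_nat_numeral of_nat_power)
    then have "snd v - k0 < d" by (meson less_exp order_less_le_trans)
    then show ?thesis using ge by auto
  qed
  then show ?thesis by blast
qed

lemma levels_finite: "finite (levels i)" and levels_card: "card (levels i) \<le> d"
proof -
  obtain k0 where k0: "\<forall>v\<in>V. snd v \<in> {k0..<k0 + d}" using ex_level_window by blast
  have sub: "levels i \<subseteq> {k0..<k0 + d}"
  proof
    fix k assume "k \<in> levels i"
    then have "(i, k) \<in> V" by (simp add: V_def levels_def)
    then show "k \<in> {k0..<k0 + d}" using k0 by fastforce
  qed
  show "finite (levels i)" using sub by (rule finite_subset) simp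
  show "card (levels i) \<le> d" using card_mono[OF _ sub] by simp
qed

lemma V_eq: "V = Sigma {..<h} levels"
proof
  show "V \<subseteq> Sigma {..<h} levels" using V_fst by (auto simp: levels_def V_def)
qed (auto simp: V_def levels_def)

lemma V_finite: "finite V"
  unfolding V_eq using levels_finite by (intro finite_SigmaI) auto

lemma sum_V: "(\<Sum>v\<in>V. f v) = (\<Sum>i<h. \<Sum>k\<in>levels i. f (i, k))"
  unfolding V_eq using levels_finite by (subst sum.Sigma) (auto simp: split_def)

lemma a_le_n: "a v \<le> n"
proof (cases "v \<in> V")
  case True
  obtain i k where v: "v = (i, k)" by force
  have "i < h" "k \<in> levels i" using True V_fst[OF True] by (auto simp: v levels_def V_def)
  then have "a (i, k) \<le> (\<Sum>k\<in>levels i. a (i, k))"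
    using levels_finite by (intro member_le_sum) auto
  also have "\<dots> \<le> n" using pattern \<open>i < h\<close> unfolding is_pattern_def levels_def by blast
  finally show ?thesis by (simp add: v)
qed (auto simp: V_def)

lemma sum_mass: "(\<Sum>i<h. mass i) \<le> 10" "(\<Sum>v\<in>V. (w v)\<^sup>2 * real (a v)) \<le> 10"
proof -
  show "(\<Sum>v\<in>V. (w v)\<^sup>2 * real (a v)) \<le> 10"
    using pattern unfolding is_pattern_def V_def by blast
  then show "(\<Sum>i<h. mass i) \<le> 10" by (simp add: sum_V mass_def)
qed

lemma mass_nonneg: "0 \<le> mass i"
  unfolding mass_def by (intro sum_nonneg) auto

lemma mu_pos: "v \<in> V \<Longrightarrow> u \<in> V \<Longrightarrow> 0 < mu v u"
  using n_pos by (simp add: mu_def V_def)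

lemma dev_nonneg: "v \<in> V \<Longrightarrow> u \<in> V \<Longrightarrow> 0 \<le> dev v u"
  using rel_dev_nonneg[OF _ mu_pos[of v u]] by (simp add: dev_def)

lemma dev_sym: "dev v u = dev u v"
proof (cases "adj v u")
  case True
  then have "adj u v" using adj_sym by blast
  then show ?thesis using True by (simp add: dev_def mu_def e_sym[OF True] mult.commute)
next
  case False
  then have "\<not> adj u v" using adj_sym by blast
  then show ?thesis using False by (simp add: dev_def)
qed

lemma logbinom_nonneg: "0 \<le> logbinom v"
proof -
  have "0 < n choose min (a v) (n div 2)" by (intro zero_less_binomial) auto
  then have "1 \<le> real (n choose min (a v) (n div 2))" by linarith
  then show ?thesis unfolding logbinom_def by (rule ln_ge_zero)
qed

lemma logbinom_le: "v \<in> V \<Longrightarrow> logbinom v \<le> real (a v) * (1 + ln (real n / real (a v)))"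
  unfolding logbinom_def using a_le_n[of v] by (intro choose_le_exp) (auto simp: V_def)

lemma card_nbrs: "i < h \<Longrightarrow> card {i'. adjH i i'} = d" "i < h \<Longrightarrow> card {i'. adjH i' i} = d"
proof -
  assume i: "i < h"
  show 1: "card {i'. adjH i i'} = d" using regular i by (auto simp: regular_graph_def)
  have "{i'. adjH i' i} = {i'. adjH i i'}" using regular by (auto simp: regular_graph_def)
  then show "card {i'. adjH i' i} = d" using 1 by simp
qed

lemma nbrs_subset: "{i'. adjH i i'} \<subseteq> {..<h}" "{i'. adjH i' i} \<subseteq> {..<h}"
  using regular by (auto simp: regular_graph_def)

lemma nbrs_finite: "finite {i'. adjH i i'}" "finite {i'. adjH i' i}"
  using nbrs_subset[of i] by (auto intro: finite_subset)

text \<open>With \<open>r = e / mu\<close>: the Gaussian regime \<open>r \<le> 8\<close> is the first summand.  For larger \<open>r\<close>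
  either \<open>ln r\<close> is at least \<open>(1 + ln (n / a v)) / z\<close>, and the deviation of the pair pays for it,
  or \<open>e v u\<close> is so small that it can be charged to the mass of \<open>u\<close>.\<close>

lemma pair_bound:
  assumes vu: "v \<in> V" "u \<in> V" and adj: "adj v u"
  defines "z \<equiv> sqrt d * w v / w u" and "l \<equiv> 1 + ln (real n / real (a v))"
  shows "w v * w u * \<bar>real (e v u) - mu v u\<bar> \<le>
    3 * (w v * w u * sqrt (mu v u * dev v u)) + (w v)\<^sup>2 * sqrt d * (2 * dev v u / l) +
    (w u)\<^sup>2 * real (a u) / sqrt d * (3 / z)"
proof -
  have mu: "0 < mu v u" using mu_pos vu by blast
  have dev: "dev v u = rel_dev (e v u) (mu v u)" "0 \<le> dev v u"
    using adj dev_nonneg[OF vu] by (simp_all add: dev_def)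
  have w: "0 < w v" "0 < w u" using wt_pos by auto
  have d: "0 < sqrt (real d)" using d_ge_2 by simp
  have av: "0 < real (a v)" "real (a v) \<le> real n" using vu a_le_n by (auto simp: V_def)
  then have l: "1 \<le> l" by (simp add: l_def)
  have z: "1 < z"
  proof -
    have "sqrt d * (1 / sqrt d) < sqrt d * (w v / w u)"
      using adj d by (intro mult_strict_left_mono) (auto simp: Gamma_adj_def)
    then show ?thesis using d by (simp add: z_def)
  qed
  have wvu: "w v = z / sqrt d * w u" using w d by (simp add: z_def)
  have nn: "0 \<le> 3 * (w v * w u * sqrt (mu v u * dev v u))"
    "0 \<le> (w v)\<^sup>2 * sqrt d * (2 * dev v u / l)"
    "0 \<le> (w u)\<^sup>2 * real (a u) / sqrt d * (3 / z)"
    using w mu dev l z d by (auto intro!: mult_nonneg_nonneg divide_nonneg_nonneg)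
  show ?thesis
  proof (cases "real (e v u) \<le> 8 * mu v u")
    case True
    have "\<bar>real (e v u) - mu v u\<bar> \<le> sqrt (9 * mu v u * dev v u)"
      unfolding dev using rel_dev_ge_square[OF _ mu True] by (intro real_le_rsqrt) auto
    also have "\<dots> = 3 * sqrt (mu v u * dev v u)"
      using real_sqrt_mult[of 9] by (simp add: mult.assoc)
    finally have "w v * w u * \<bar>real (e v u) - mu v u\<bar> \<le> w v * w u * (3 * sqrt (mu v u * dev v u))"
      using w by (intro mult_left_mono) auto
    also have "\<dots> = 3 * (w v * w u * sqrt (mu v u * dev v u))" by (simp only: mult_ac)
    finally show ?thesis by (intro add_increasing2 nn)
  next
    case False
    define r where "r = ln (real (e v u) / mu v u)"
    have r: "2 \<le> r" "real (e v u) * r \<le> 2 * dev v u"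
      unfolding dev r_def using rel_dev_ge_ln[of "mu v u" "e v u"] mu False by auto
    have epos: "0 < real (e v u)" using False mu by linarith
    have "w v * w u * \<bar>real (e v u) - mu v u\<bar> \<le> w v * w u * real (e v u)"
      using w mu False by (intro mult_left_mono) auto
    also have "w v * w u * real (e v u) \<le> (w v)\<^sup>2 * sqrt d * (2 * dev v u / l) +
       (w u)\<^sup>2 * real (a u) / sqrt d * (3 / z)"
    \<comment> \<open>Here w v * w u = (w v)^2 sqrt d / z, so the deviation pays if
      \<open>e / z\<close> is at most \<open>e * r / l\<close>.\<close>
    proof (cases "l / z \<le> r")
      case True
      have "real (e v u) / z = real (e v u) * (l / z) / l" using l by simp
      also have "\<dots> \<le> real (e v u) * r / l"
        using True l by (intro divide_right_mono mult_left_mono) auto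
      also have "\<dots> \<le> 2 * dev v u / l" using r l by (intro divide_right_mono) auto
      finally have "(w v)\<^sup>2 * sqrt d * (real (e v u) / z) \<le> (w v)\<^sup>2 * sqrt d * (2 * dev v u / l)"
        by (intro mult_left_mono) auto
      moreover have "(w v)\<^sup>2 * sqrt d * (real (e v u) / z) = w v * w u * real (e v u)"
        using w d by (simp add: z_def power2_eq_square)
      ultimately show ?thesis by (intro add_increasing2 nn) simp
    next
      case F: False
      have lz: "r * z < l" using F z by (simp add: field_simps)
      then have l2z: "2 * z \<le> l" using r(1) z mult_right_mono[of 2 r z] by linarith
      have "real (e v u) = mu v u * exp r" using mu epos by (simp add: r_def)
      \<comment> \<open>By definition exp (l - 1) = n / a v. With r < l / z and 2 z \<le> l the
        exponent 1 - l + r drops below 3 - 2 z.\<close>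
      also have "mu v u = real (a u) * exp (1 - l)"
        using av n_pos by (simp add: mu_def l_def exp_minus exp_diff field_simps)
      also have "real (a u) * exp (1 - l) * exp r = real (a u) * exp (1 - l + r)"
        by (simp only: mult.assoc exp_add)
      also have "\<dots> \<le> real (a u) * exp (3 - 2 * z)"
      proof (intro mult_left_mono)
        have "r < l / z" using F by simp
        moreover have "2 * z * (1 - 1 / z) \<le> l * (1 - 1 / z)"
          using l2z z by (intro mult_right_mono) auto
        then have "2 * z - 2 \<le> l - l / z" using z by (simp add: algebra_simps)
        ultimately show "exp (1 - l + r) \<le> exp (3 - 2 * z)" by simp
      qed simp
      finally have e: "real (e v u) \<le> real (a u) * exp (3 - 2 * z)" .
      have "w v * w u * real (e v u) \<le> w v * w u * (real (a u) * exp (3 - 2 * z))"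
        using e w by (intro mult_left_mono) auto
      also have "\<dots> = (w u)\<^sup>2 * real (a u) / sqrt d * (z * exp (3 - 2 * z))"
        unfolding wvu by (simp add: power2_eq_square)
      also have "\<dots> \<le> (w u)\<^sup>2 * real (a u) / sqrt d * (3 / z)"
      proof (intro mult_left_mono)
        \<comment> \<open>Squaring this gives z^2 exp (3 - 2 z) \<le> e \<le> 3, the origin of the 3
          in \<open>3 / z\<close>.\<close>
        have "z \<le> exp (z - 1)" using exp_ge_add_one_self[of "z - 1"] by simp
        then have "z * z \<le> exp (z - 1) * exp (z - 1)" using z by (intro mult_mono) auto
        then have "z * z * exp (3 - 2 * z) \<le> exp (z - 1) * exp (z - 1) * exp (3 - 2 * z)"
          by (intro mult_right_mono) auto
        also have "\<dots> = exp 1" by (simp add: exp_add[symmetric])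
        also have "\<dots> \<le> 3" using exp_le by simp
        finally show "z * exp (3 - 2 * z) \<le> 3 / z" using z by (simp add: field_simps)
      qed (use d in auto)
      finally show ?thesis by (intro add_increasing nn)
    qed
    finally show ?thesis unfolding add.assoc by (rule add_increasing[OF nn(1)])
  qed
qed

section \<open>Summing the three parts of the pair bound\<close>

text \<open>With u = w sqrt (n / mass), a \<le> n gives w sqrt a \<le> u sqrt mass, while w^2 a
  \<le> mass gives both w sqrt a \<le> sqrt mass and a / n \<le> 1 / u^2. The fourth root of a / n
  supplies the decay for large u, so the bound does not involve the number of levels.\<close>

lemma level_sum: "(\<Sum>k\<in>levels i. wt n h k * sqrt (a (i, k)) * sqrt (sqrt (a (i, k) / n))) \<le> 6 * sqrt (mass i)"
proof (cases "mass i = 0")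
  case True
  have "a (i, k) = 0" if "k \<in> levels i" for k
  proof -
    have "(wt n h k)\<^sup>2 * real (a (i, k)) = 0"
      using True that levels_finite unfolding mass_def by (subst (asm) sum_nonneg_eq_0_iff) auto
    then show ?thesis using wt_pos[of k] by simp
  qed
  then show ?thesis using True by simp
next
  case False
  define x where "x = mass i"
  define r where "r = wt n h 0 * sqrt (n / x)"
  have x: "0 < x" using False mass_nonneg[of i] by (simp add: x_def)
  have r: "0 < r" using x wt_pos n_pos by (simp add: r_def)
  have "wt n h k * sqrt (a (i, k)) * sqrt (sqrt (a (i, k) / n)) \<le>
      sqrt x * min (2 ^ k * r) (1 / sqrt (2 ^ k * r))" if k: "k \<in> levels i" for k
  proof -
    define u where "u = 2 ^ k * r"
    have u: "0 < u" "u = wt n h k * sqrt (n / x)" using r by (auto simp: u_def r_def wt_eq[of k])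
    have wk: "0 < wt n h k" by (rule wt_pos)
    have "(wt n h k)\<^sup>2 * real (a (i, k)) \<le> x"
      unfolding x_def mass_def using k levels_finite by (intro member_le_sum) auto
    then have 1: "wt n h k * sqrt (a (i, k)) \<le> sqrt x"
      using wk by (intro real_le_rsqrt) (simp add: power_mult_distrib)
    have an: "real (a (i, k)) / n \<le> 1" using a_le_n[of "(i, k)"] n_pos by simp
    have 2: "wt n h k * sqrt (a (i, k)) \<le> sqrt x * u"
    proof -
      have "wt n h k * sqrt (a (i, k)) \<le> wt n h k * sqrt n"
        using a_le_n[of "(i, k)"] wk by (intro mult_left_mono) auto
      also have "\<dots> = sqrt x * u" using x by (simp add: u(2) real_sqrt_divide)
      finally show ?thesis .
    qed
    have 3: "sqrt (sqrt (a (i, k) / n)) \<le> 1" using an by simp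
    have 4: "sqrt (sqrt (a (i, k) / n)) \<le> 1 / sqrt u"
    proof -
      have "sqrt (a (i, k) / n) = wt n h k * sqrt (a (i, k)) / (wt n h k * sqrt n)"
        using wk by (simp add: real_sqrt_divide)
      also have "\<dots> \<le> sqrt x / (wt n h k * sqrt n)"
        using 1 wk by (intro divide_right_mono) auto
      also have "\<dots> = 1 / u" using x by (simp add: u(2) real_sqrt_divide)
      finally have "sqrt (sqrt (a (i, k) / n)) \<le> sqrt (1 / u)" by (rule real_sqrt_le_mono)
      then show ?thesis by (simp add: real_sqrt_divide)
    qed
    have "wt n h k * sqrt (a (i, k)) * sqrt (sqrt (a (i, k) / n)) \<le> sqrt x * u * 1"
      using u x by (intro mult_mono[OF 2 3]) auto
    moreover have "wt n h k * sqrt (a (i, k)) * sqrt (sqrt (a (i, k) / n)) \<le> sqrt x * (1 / sqrt u)"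
      using x by (intro mult_mono[OF 1 4]) auto
    ultimately show ?thesis unfolding u_def[symmetric] by (auto simp: min_def)
  qed
  then have "(\<Sum>k\<in>levels i. wt n h k * sqrt (a (i, k)) * sqrt (sqrt (a (i, k) / n))) \<le>
      (\<Sum>k\<in>levels i. sqrt x * min (2 ^ k * r) (1 / sqrt (2 ^ k * r)))"
    by (intro sum_mono)
  also have "\<dots> \<le> sqrt x * 6"
    unfolding sum_distrib_left[symmetric] using x
    by (intro mult_left_mono sum_min_geometric_le levels_finite r) auto
  finally show ?thesis by (simp add: x_def)
qed

lemma sum_nbr_mass: "(\<Sum>i<h. \<Sum>i' | adjH i i'. mass i') \<le> 10 * real d"
proof -
  have "(\<Sum>i<h. \<Sum>i' | adjH i i'. mass i') = (\<Sum>i<h. \<Sum>i'<h. if adjH i i' then mass i' else 0)"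
  proof (rule sum.cong[OF refl])
    fix i assume "i \<in> {..<h}"
    have "{i'. adjH i i'} = {i' \<in> {..<h}. adjH i i'}" using nbrs_subset by auto
    then show "(\<Sum>i' | adjH i i'. mass i') = (\<Sum>i'<h. if adjH i i' then mass i' else 0)"
      by (simp only: sum.inter_filter[OF finite_lessThan])
  qed
  also have "\<dots> = (\<Sum>i'<h. \<Sum>i<h. if adjH i i' then mass i' else 0)" by (rule sum.swap)
  also have "\<dots> = (\<Sum>i'<h. real d * mass i')"
  proof (intro sum.cong refl)
    fix i' assume "i' \<in> {..<h}"
    have "{i. adjH i i'} = {i \<in> {..<h}. adjH i i'}" using nbrs_subset by auto
    then have "(\<Sum>i<h. if adjH i i' then mass i' else 0) = (\<Sum>i | adjH i i'. mass i')"
      by (simp only: sum.inter_filter[OF finite_lessThan])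
    then show "(\<Sum>i<h. if adjH i i' then mass i' else 0) = real d * mass i'"
      using card_nbrs(2)[of i'] \<open>i' \<in> _\<close> by simp
  qed
  also have "\<dots> = real d * (\<Sum>i'<h. mass i')" by (simp add: sum_distrib_left)
  also have "\<dots> \<le> real d * 10" by (intro mult_left_mono sum_mass) auto
  finally show ?thesis by simp
qed

text \<open>Cauchy-Schwarz over \<open>u\<close> separates the neighbouring mass from the load at
  \<open>v\<close>. Bounding the load by the entropy of \<open>a v\<close> and using
  \<open>entropy_le_sqrt\<close> produces the fourth root of a / n needed in
  \<open>level_sum\<close>.\<close>

lemma gaussian_vertex_bound:
  assumes v: "v \<in> V" and L: "0 \<le> L" and U: "U \<subseteq> V" "\<And>u. u \<in> U \<Longrightarrow> adj v u"
    and load: "(\<Sum>u\<in>U. dev v u) \<le> L / 5 * logbinom v"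
  shows "(\<Sum>u\<in>U. w v * w u * sqrt (mu v u * dev v u)) \<le>
    sqrt (2 * L / 5) * (sqrt (\<Sum>i' | adjH (fst v) i'. mass i') *
      (w v * sqrt (a v) * sqrt (sqrt (a v / n))))"
proof -
  let ?Z = "\<Sum>i' | adjH (fst v) i'. mass i'"
  have av: "0 < real (a v)" using v by (simp add: V_def)
  have n: "0 < real n" using n_pos by simp
  have "(\<Sum>u\<in>U. (w u)\<^sup>2 * real (a u)) \<le> (\<Sum>u\<in>Sigma {i'. adjH (fst v) i'} levels. (w u)\<^sup>2 * real (a u))"
  proof (intro sum_mono2)
    show "finite (Sigma {i'. adjH (fst v) i'} levels)"
      using nbrs_finite levels_finite by (intro finite_SigmaI) auto
    show "U \<subseteq> Sigma {i'. adjH (fst v) i'} levels"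
      using U by (fastforce simp: V_def levels_def Gamma_adj_def)
  qed auto
  also have "\<dots> = ?Z"
    unfolding mass_def using nbrs_finite levels_finite by (subst sum.Sigma) (auto simp: split_def)
  finally have Z: "(\<Sum>u\<in>U. (w u)\<^sup>2 * real (a u)) \<le> ?Z" .
  have "(\<Sum>u\<in>U. w v * w u * sqrt (mu v u * dev v u)) =
      w v * sqrt (a v / n) * (\<Sum>u\<in>U. sqrt ((w u)\<^sup>2 * real (a u)) * sqrt (dev v u))"
    unfolding sum_distrib_left
  proof (intro sum.cong refl)
    fix u
    have "sqrt ((w u)\<^sup>2 * real (a u)) = w u * sqrt (a u)"
      using wt_pos[of "snd u"] by (simp add: real_sqrt_mult)
    moreover have "sqrt (mu v u * dev v u) = sqrt (a v / n) * sqrt (a u) * sqrt (dev v u)"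
      by (simp add: mu_def real_sqrt_mult real_sqrt_divide)
    ultimately show "w v * w u * sqrt (mu v u * dev v u) =
        w v * sqrt (a v / n) * (sqrt ((w u)\<^sup>2 * real (a u)) * sqrt (dev v u))"
      by (simp only: mult_ac)
  qed
  also have "\<dots> \<le> w v * sqrt (a v / n) * (sqrt ?Z * sqrt (L / 5 * logbinom v))"
  proof (intro mult_left_mono)
    have "(\<Sum>u\<in>U. sqrt ((w u)\<^sup>2 * real (a u)) * sqrt (dev v u)) \<le>
        sqrt (\<Sum>u\<in>U. (w u)\<^sup>2 * real (a u)) * sqrt (\<Sum>u\<in>U. dev v u)"
      using U(1) dev_nonneg[OF v] by (intro Cauchy_Schwarz_sqrt_sum) (simp, blast)
    also have "\<dots> \<le> sqrt ?Z * sqrt (L / 5 * logbinom v)"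
    proof (rule mult_mono)
      show "0 \<le> sqrt ?Z" by (intro real_sqrt_ge_zero sum_nonneg mass_nonneg)
      show "0 \<le> sqrt (\<Sum>u\<in>U. dev v u)"
        by (intro real_sqrt_ge_zero sum_nonneg dev_nonneg v) (use U in auto)
    qed (intro real_sqrt_le_mono Z load)+
    finally show "(\<Sum>u\<in>U. sqrt ((w u)\<^sup>2 * real (a u)) * sqrt (dev v u)) \<le>
        sqrt ?Z * sqrt (L / 5 * logbinom v)" .
  qed (use wt_pos[of "snd v"] in auto)
  also have "\<dots> = w v * sqrt ?Z * (sqrt (a v / n) * sqrt (L / 5 * logbinom v))" by (simp only: mult_ac)
  also have "sqrt (a v / n) * sqrt (L / 5 * logbinom v) \<le> sqrt (2 * L / 5) * sqrt (a v) * sqrt (sqrt (a v / n))"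
    unfolding real_sqrt_mult[symmetric]
  proof (rule real_sqrt_le_mono)
    define y where "y = real (a v) / n"
    have y: "0 < y" "1 / y = real n / a v" using av n by (auto simp: y_def)
    have "y * (L / 5 * logbinom v) \<le> y * (L / 5 * (real (a v) * (1 + ln (1 / y))))"
      using logbinom_le[OF v] L y by (intro mult_left_mono) auto
    also have "\<dots> = L / 5 * real (a v) * (y * (1 + ln (1 / y)))" by (simp only: mult_ac)
    also have "\<dots> \<le> L / 5 * real (a v) * (2 * sqrt y)"
      using L y entropy_le_sqrt[of y] by (intro mult_left_mono) auto
    also have "\<dots> = 2 * L / 5 * real (a v) * sqrt y" by simp
    finally show "real (a v) / n * (L / 5 * logbinom v) \<le> 2 * L / 5 * real (a v) * sqrt (real (a v) / n)"
      by (simp only: y_def)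
  qed
  also have "w v * sqrt ?Z * (sqrt (2 * L / 5) * sqrt (a v) * sqrt (sqrt (a v / n))) =
      sqrt (2 * L / 5) * (sqrt ?Z * (w v * sqrt (a v) * sqrt (sqrt (a v / n))))"
    by (simp only: mult_ac)
  finally show ?thesis
    using wt_pos[of "snd v"] by (simp add: mult_left_mono sum_nonneg mass_nonneg)
qed

text \<open>Cauchy-Schwarz over the fibres: 6 comes from the levels, and sqrt (10 d) sqrt 10 from
  the neighbouring and the own masses.\<close>

lemma gaussian_total:
  "(\<Sum>v\<in>V. sqrt (\<Sum>i' | adjH (fst v) i'. mass i') * (w v * sqrt (a v) * sqrt (sqrt (a v / n))))
     \<le> 60 * sqrt d"
proof -
  let ?Z = "\<lambda>i. \<Sum>i' | adjH i i'. mass i'"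
  have Z: "0 \<le> ?Z i" for i by (intro sum_nonneg mass_nonneg)
  have "(\<Sum>v\<in>V. sqrt (?Z (fst v)) * (w v * sqrt (a v) * sqrt (sqrt (a v / n)))) =
      (\<Sum>i<h. sqrt (?Z i) * (\<Sum>k\<in>levels i. wt n h k * sqrt (a (i, k)) * sqrt (sqrt (a (i, k) / n))))"
    by (simp only: sum_V fst_conv snd_conv sum_distrib_left)
  also have "\<dots> \<le> (\<Sum>i<h. sqrt (?Z i) * (6 * sqrt (mass i)))"
    by (intro sum_mono mult_left_mono level_sum real_sqrt_ge_zero Z)
  also have "\<dots> = 6 * (\<Sum>i<h. sqrt (?Z i) * sqrt (mass i))"
    by (simp add: sum_distrib_left mult_ac)
  also have "(\<Sum>i<h. sqrt (?Z i) * sqrt (mass i)) \<le> sqrt (\<Sum>i<h. ?Z i) * sqrt (\<Sum>i<h. mass i)"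
    by (intro Cauchy_Schwarz_sqrt_sum Z mass_nonneg)
  also have "\<dots> \<le> sqrt (10 * real d) * sqrt 10"
    by (intro mult_mono real_sqrt_le_mono sum_nbr_mass sum_mass) (auto intro!: sum_nonneg mass_nonneg)
  also have "\<dots> = 10 * sqrt d" by (simp add: real_sqrt_mult)
  finally show ?thesis by simp
qed

text \<open>The divisor \<open>l\<close> cancels the same factor in the bound a v * l for
  \<open>logbinom v\<close>, leaving just the contribution of \<open>v\<close> to the total
  mass.\<close>

lemma poisson_vertex_bound:
  assumes v: "v \<in> V" and load: "(\<Sum>u\<in>U. dev v u) \<le> L / 5 * logbinom v" and L: "0 \<le> L"
  defines "l \<equiv> 1 + ln (real n / real (a v))"
  shows "(\<Sum>u\<in>U. (w v)\<^sup>2 * sqrt d * (2 * dev v u / l)) \<le> 2 * L / 5 * sqrt d * ((w v)\<^sup>2 * real (a v))"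
proof -
  have "0 < real (a v)" "real (a v) \<le> real n" using v a_le_n by (auto simp: V_def)
  then have l: "1 \<le> l" by (simp add: l_def)
  have "(\<Sum>u\<in>U. (w v)\<^sup>2 * sqrt d * (2 * dev v u / l)) = (w v)\<^sup>2 * sqrt d * (2 / l) * (\<Sum>u\<in>U. dev v u)"
    by (simp add: sum_distrib_left sum_divide_distrib mult_ac)
  also have "\<dots> \<le> (w v)\<^sup>2 * sqrt d * (2 / l) * (L / 5 * (real (a v) * l))"
  proof (rule mult_left_mono)
    have "L / 5 * logbinom v \<le> L / 5 * (real (a v) * l)"
      using L logbinom_le[OF v] unfolding l_def by (intro mult_left_mono) auto
    then show "(\<Sum>u\<in>U. dev v u) \<le> L / 5 * (real (a v) * l)" using load by linarith
  qed (use l in auto)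
  also have "\<dots> = 2 * L / 5 * sqrt d * ((w v)\<^sup>2 * real (a v))" using l by simp
  finally show ?thesis .
qed

text \<open>Adjacency forces each quotient sqrt d * w v / w u above 1, and within one fibre these
  quotients are dyadic. So each of the \<open>d\<close> neighbouring fibres contributes at most 3 *
  2.\<close>

lemma sum_inverse_z:
  assumes u: "fst u < h"
  shows "(\<Sum>v | v \<in> V \<and> adj v u. 3 / (sqrt d * w v / w u)) \<le> 6 * real d"
proof -
  define r where "r = sqrt d / 2 ^ snd u"
  have r: "0 < r" using d_ge_2 by (simp add: r_def)
  have z: "sqrt d * w v / w u = 2 ^ snd v * r" for v
    using wt_ratio[of "snd v" "snd u"] by (simp add: r_def) (metis times_divide_eq_right mult.commute)
  let ?K = "\<lambda>i. {k \<in> levels i. 1 < 2 ^ k * r}"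
  have fin: "finite (Sigma {i. adjH i (fst u)} ?K)"
    using nbrs_finite levels_finite by (intro finite_SigmaI) auto
  have "(\<Sum>v | v \<in> V \<and> adj v u. 3 / (sqrt d * w v / w u)) \<le>
      (\<Sum>v\<in>Sigma {i. adjH i (fst u)} ?K. 3 / (sqrt d * w v / w u))"
  proof (intro sum_mono2 fin subsetI)
    fix v assume v: "v \<in> {v. v \<in> V \<and> adj v u}"
    have "sqrt d * (1 / sqrt d) < sqrt d * (w v / w u)"
      using v d_ge_2 by (intro mult_strict_left_mono) (auto simp: Gamma_adj_def)
    then have "1 < sqrt d * w v / w u" using d_ge_2 by simp
    then show "v \<in> Sigma {i. adjH i (fst u)} ?K"
      using v unfolding z by (cases v) (auto simp: V_def levels_def Gamma_adj_def)
  qed (use r in \<open>auto simp: z\<close>)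
  also have "\<dots> = (\<Sum>i | adjH i (fst u). \<Sum>k\<in>?K i. 3 * (1 / (2 ^ k * r)))"
    unfolding z using nbrs_finite levels_finite by (subst sum.Sigma) (auto simp: split_def)
  also have "\<dots> \<le> (\<Sum>i | adjH i (fst u). 6)"
  proof (rule sum_mono)
    fix i
    have "(\<Sum>k\<in>?K i. 1 / (2 ^ k * r)) \<le> 2"
      using levels_finite r by (intro sum_inverse_geometric_le) auto
    then show "(\<Sum>k\<in>?K i. 3 * (1 / (2 ^ k * r))) \<le> 6" unfolding sum_distrib_left[symmetric] by linarith
  qed
  also have "\<dots> = 6 * real d" using card_nbrs(2)[OF u] by simp
  finally show ?thesis .
qed

text \<open>\<open>Q\<close> is enlarged to all adjacent pairs and regrouped by the endpoint
  \<open>u\<close> that carries the charge; 6 d / sqrt d times the total mass 10 gives the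
  bound.\<close>

lemma charged_total:
  assumes "Q \<subseteq> V \<times> V" "\<And>v u. (v, u) \<in> Q \<Longrightarrow> adj v u"
  shows "(\<Sum>(v, u)\<in>Q. (w u)\<^sup>2 * real (a u) / sqrt d * (3 / (sqrt d * w v / w u))) \<le> 60 * sqrt d"
proof -
  let ?g = "\<lambda>v u. (w u)\<^sup>2 * real (a u) / sqrt d * (3 / (sqrt d * w v / w u))"
  have g: "0 \<le> ?g v u" for v u
    using wt_pos[of "snd v"] wt_pos[of "snd u"] by (intro mult_nonneg_nonneg divide_nonneg_nonneg) auto
  have "(\<Sum>(v, u)\<in>Q. ?g v u) = (\<Sum>(u, v)\<in>Q\<inverse>. ?g v u)"
    by (rule sum.reindex_bij_witness[of _ prod.swap prod.swap]) auto
  also have "\<dots> \<le> (\<Sum>(u, v)\<in>Sigma V (\<lambda>u. {v. v \<in> V \<and> adj v u}). ?g v u)"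
    using assms V_finite g by (intro sum_mono2 finite_SigmaI) (auto split: prod.splits)
  also have "\<dots> = (\<Sum>u\<in>V. \<Sum>v | v \<in> V \<and> adj v u. ?g v u)"
    using V_finite by (intro sum.Sigma[symmetric]) auto
  also have "\<dots> = (\<Sum>u\<in>V. (w u)\<^sup>2 * real (a u) / sqrt d * (\<Sum>v | v \<in> V \<and> adj v u. 3 / (sqrt d * w v / w u)))"
    by (simp only: sum_distrib_left)
  also have "\<dots> \<le> (\<Sum>u\<in>V. (w u)\<^sup>2 * real (a u) / sqrt d * (6 * real d))"
    by (intro sum_mono mult_left_mono sum_inverse_z V_fst) auto
  also have "\<dots> = 6 * (real d / sqrt d) * (\<Sum>u\<in>V. (w u)\<^sup>2 * real (a u))"
    by (simp add: sum_distrib_left mult_ac)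
  also have "real d / sqrt d = sqrt d" by (simp add: real_div_sqrt)
  also have "6 * sqrt d * (\<Sum>u\<in>V. (w u)\<^sup>2 * real (a u)) \<le> 6 * sqrt d * 10"
    by (intro mult_left_mono sum_mass) auto
  finally show ?thesis by simp
qed

lemma loss_bound:
  assumes Q: "Q \<subseteq> V \<times> V" and L: "20 \<le> L"
    and load: "\<And>v. v \<in> V \<Longrightarrow> (\<Sum>u | (v, u) \<in> Q. dev v u) \<le> L / 5 * logbinom v"
  shows "(\<Sum>(v, u) | (v, u) \<in> Q \<and> adj v u. w v * w u * \<bar>real (e v u) - mu v u\<bar>) \<le> 55 * L * sqrt d"
proof -
  let ?Q = "{(v, u). (v, u) \<in> Q \<and> adj v u}"
  let ?U = "\<lambda>v. {u. (v, u) \<in> Q \<and> adj v u}"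
  let ?l = "\<lambda>v. 1 + ln (real n / real (a v))"
  let ?A = "\<lambda>v u. w v * w u * sqrt (mu v u * dev v u)"
  let ?B = "\<lambda>v u. (w v)\<^sup>2 * sqrt d * (2 * dev v u / ?l v)"
  let ?C = "\<lambda>v u. (w u)\<^sup>2 * real (a u) / sqrt d * (3 / (sqrt d * w v / w u))"
  have UV: "?U v \<subseteq> V" for v using Q by auto
  have finU: "finite (?U v)" for v using UV V_finite finite_subset by blast
  have Qeq: "?Q = Sigma V ?U" using Q by auto
  have load': "(\<Sum>u\<in>?U v. dev v u) \<le> L / 5 * logbinom v" if "v \<in> V" for v
  proof -
    have "(\<Sum>u\<in>?U v. dev v u) \<le> (\<Sum>u | (v, u) \<in> Q. dev v u)"
    proof (intro sum_mono2)
      show "finite {u. (v, u) \<in> Q}" using Q V_finite by (auto intro: finite_subset[of _ V])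
    qed (use Q in \<open>auto intro!: dev_nonneg\<close>)
    then show ?thesis using load[OF that] by linarith
  qed
  have "(\<Sum>(v, u)\<in>?Q. w v * w u * \<bar>real (e v u) - mu v u\<bar>) \<le> (\<Sum>(v, u)\<in>?Q. 3 * ?A v u + ?B v u + ?C v u)"
    using Q pair_bound by (intro sum_mono) auto
  also have "\<dots> = 3 * (\<Sum>(v, u)\<in>?Q. ?A v u) + (\<Sum>(v, u)\<in>?Q. ?B v u) + (\<Sum>(v, u)\<in>?Q. ?C v u)"
    by (simp add: sum.distrib sum_distrib_left split_def)
  also have "(\<Sum>(v, u)\<in>?Q. ?C v u) \<le> 60 * sqrt d"
    using Q by (intro charged_total) auto
  also have "(\<Sum>(v, u)\<in>?Q. ?A v u) = (\<Sum>v\<in>V. \<Sum>u\<in>?U v. ?A v u)"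
    unfolding Qeq using V_finite finU by (intro sum.Sigma[symmetric]) auto
  also have "\<dots> \<le> (\<Sum>v\<in>V. sqrt (2 * L / 5) * (sqrt (\<Sum>i' | adjH (fst v) i'. mass i') *
      (w v * sqrt (a v) * sqrt (sqrt (a v / n)))))"
    using L UV load' by (intro sum_mono gaussian_vertex_bound) auto
  also have "\<dots> \<le> sqrt (2 * L / 5) * (60 * sqrt d)"
    unfolding sum_distrib_left[symmetric] using L by (intro mult_left_mono gaussian_total) auto
  also have "(\<Sum>(v, u)\<in>?Q. ?B v u) = (\<Sum>v\<in>V. \<Sum>u\<in>?U v. ?B v u)"
    unfolding Qeq using V_finite finU by (intro sum.Sigma[symmetric]) auto
  also have "\<dots> \<le> (\<Sum>v\<in>V. 2 * L / 5 * sqrt d * ((w v)\<^sup>2 * real (a v)))"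
    using L load' by (intro sum_mono poisson_vertex_bound) auto
  also have "\<dots> \<le> 2 * L / 5 * sqrt d * 10"
    unfolding sum_distrib_left[symmetric] using L by (intro mult_left_mono sum_mass) auto
  finally have "(\<Sum>(v, u)\<in>?Q. w v * w u * \<bar>real (e v u) - mu v u\<bar>) \<le>
      3 * (sqrt (2 * L / 5) * (60 * sqrt d)) + 2 * L / 5 * sqrt d * 10 + 60 * sqrt d"
    by simp
  \<comment> \<open>This is where L \<ge> 20 enters: 49 * 2/5 = 19.6 \<le> L gives sqrt (2 L / 5)
    \<le> L / 7, and 60 \<le> 3 L.\<close>
  also have "\<dots> \<le> 3 * (L / 7 * (60 * sqrt d)) + 2 * L / 5 * sqrt d * 10 + 3 * L * sqrt d"
  proof (intro add_mono mult_left_mono mult_right_mono order_refl)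
    have "2 * L / 5 \<le> (L / 7)\<^sup>2"
      using L mult_right_mono[of 20 L L] by (simp add: power2_eq_square)
    then show "sqrt (2 * L / 5) \<le> L / 7" using L by (intro real_le_lsqrt) auto
  qed (use L in auto)
  also have "\<dots> = (3 * 60 / 7 + 4 + 3) * L * sqrt d" by (simp add: algebra_simps)
  also have "\<dots> \<le> 55 * L * sqrt d" using L by (intro mult_right_mono) auto
  finally show ?thesis .
qed

section \<open>Potencies and deviations as finite sums over edges\<close>

definition edges :: "(nat \<times> nat) set \<Rightarrow> ((nat \<times> nat) \<times> (nat \<times> nat)) set" where
  "edges S = {(v, u). v \<in> S \<and> u \<in> S \<and> adj v u \<and> fst v < fst u}"

lemma edges_finite: "S \<subseteq> V \<Longrightarrow> finite (edges S)"
  by (rule finite_subset[of _ "V \<times> V"]) (auto simp: edges_def V_finite)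

lemma infsum_sub_pattern:
  assumes S: "S \<subseteq> V" and F: "F \<subseteq> Gamma_edges adjH d n h"
  shows "(\<Sum>\<^sub>\<infinity>f\<in>F. edge_term n h (sub_a S a) (sub_e S e) f) = (\<Sum>f\<in>F \<inter> edges S. edge_term n h a e f)"
proof -
  have "(\<Sum>\<^sub>\<infinity>f\<in>F. edge_term n h (sub_a S a) (sub_e S e) f) = (\<Sum>\<^sub>\<infinity>f\<in>F \<inter> edges S. edge_term n h a e f)"
  proof (rule infsum_cong_neutral)
    fix f assume f: "f \<in> F - F \<inter> edges S"
    obtain v u where vu: "f = (v, u)" by (cases f)
    have "\<not> (v \<in> S \<and> u \<in> S)" using f F by (auto simp: vu edges_def Gamma_edges_def)
    then show "edge_term n h (sub_a S a) (sub_e S e) f = 0"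
      by (auto simp: vu edge_term_def sub_a_def sub_e_def)
  qed (auto simp: edges_def edge_term_def sub_a_def sub_e_def)
  also have "\<dots> = (\<Sum>f\<in>F \<inter> edges S. edge_term n h a e f)"
    using edges_finite[OF S] by (intro infsum_finite) auto
  finally show ?thesis .
qed

text \<open>Off \<open>V\<close> the bound e \<le> min (a v) (a u) makes the edge count vanish
  together with the mean.\<close>

lemma potency_eq: "potency adjH d n h a e = \<bar>\<Sum>f\<in>edges V. edge_term n h a e f\<bar>"
proof -
  have "(\<Sum>\<^sub>\<infinity>f\<in>Gamma_edges adjH d n h. edge_term n h a e f) = (\<Sum>\<^sub>\<infinity>f\<in>edges V. edge_term n h a e f)"
  proof (rule infsum_cong_neutral)
    fix f assume "f \<in> Gamma_edges adjH d n h - edges V"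
    moreover obtain v u where vu: "f = (v, u)" by (cases f)
    ultimately have f: "adj v u" "\<not> (v \<in> V \<and> u \<in> V)" by (auto simp: Gamma_edges_def edges_def)
    then have "e v u = 0" "a v = 0 \<or> a u = 0" using e_le[OF f(1)] by (auto simp: V_def)
    then show "edge_term n h a e f = 0" by (auto simp: vu edge_term_def)
  qed (auto simp: Gamma_edges_def edges_def)
  also have "\<dots> = (\<Sum>f\<in>edges V. edge_term n h a e f)"
    using edges_finite[of V] by (intro infsum_finite) auto
  finally show ?thesis by (simp add: potency_def)
qed

text \<open>The supremum is evaluated at the full edge set. Boundedness has to be checked first, by
  the sum of absolute values, because a real supremum is meaningful only then.\<close>

lemma potency_tilde_ge:
  assumes S: "S \<subseteq> V"
  shows "\<bar>\<Sum>f\<in>edges S. edge_term n h a e f\<bar> \<le> potency_tilde adjH d n h (sub_a S a) (sub_e S e)"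
proof -
  let ?G = "Gamma_edges adjH d n h"
  let ?g = "\<lambda>F. \<bar>\<Sum>\<^sub>\<infinity>f\<in>F. edge_term n h (sub_a S a) (sub_e S e) f\<bar>"
  have "bdd_above (?g ` Pow ?G)"
  proof (rule bdd_aboveI2)
    fix F assume "F \<in> Pow ?G"
    then have "?g F = \<bar>\<Sum>f\<in>F \<inter> edges S. edge_term n h a e f\<bar>" using infsum_sub_pattern[OF S] by auto
    also have "\<dots> \<le> (\<Sum>f\<in>F \<inter> edges S. \<bar>edge_term n h a e f\<bar>)" by (rule sum_abs)
    also have "\<dots> \<le> (\<Sum>f\<in>edges S. \<bar>edge_term n h a e f\<bar>)"
      using edges_finite[OF S] by (intro sum_mono2) auto
    finally show "?g F \<le> (\<Sum>f\<in>edges S. \<bar>edge_term n h a e f\<bar>)" .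
  qed
  then have "?g ?G \<le> potency_tilde adjH d n h (sub_a S a) (sub_e S e)"
    unfolding potency_tilde_def by (intro cSUP_upper) auto
  moreover have "?G \<inter> edges S = edges S" by (auto simp: Gamma_edges_def edges_def)
  ultimately show ?thesis using infsum_sub_pattern[OF S order_refl] by simp
qed

lemma potency_loss:
  assumes S: "S \<subseteq> V" and Q: "Q \<subseteq> V \<times> V"
    and cover: "\<And>v u. v \<in> V \<Longrightarrow> u \<in> V \<Longrightarrow> v \<in> S \<and> u \<in> S \<or> (v, u) \<in> Q \<or> (u, v) \<in> Q"
  shows "potency adjH d n h a e \<le> potency_tilde adjH d n h (sub_a S a) (sub_e S e) +
    (\<Sum>(v, u) | (v, u) \<in> Q \<and> adj v u. w v * w u * \<bar>real (e v u) - mu v u\<bar>)"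
proof -
  let ?t = "edge_term n h a e"
  let ?g = "\<lambda>(v, u). w v * w u * \<bar>real (e v u) - mu v u\<bar>"
  let ?Q = "{(v, u). (v, u) \<in> Q \<and> adj v u}"
  \<comment> \<open>Reorients a lost edge to a pair recorded in \<open>Q\<close>. It is injective
    because \<open>edges\<close> holds each edge in one orientation only.\<close>
  let ?\<phi> = "\<lambda>(v, u). if (v, u) \<in> Q then (v, u) else (u, v)"
  have sub: "edges S \<subseteq> edges V" using S by (auto simp: edges_def)
  have finQ: "finite ?Q" by (rule finite_subset[of _ "V \<times> V"]) (use Q V_finite in auto)
  have t: "\<bar>?t f\<bar> = ?g f" for f
    using wt_pos by (auto simp: edge_term_def mu_def abs_mult abs_of_pos split: prod.splits)
  have gsym: "?g (v, u) = ?g (u, v)" if "adj v u" for v u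
    using e_sym[OF that] by (simp add: mu_def mult.commute)
  have "\<bar>\<Sum>f\<in>edges V. ?t f\<bar> = \<bar>(\<Sum>f\<in>edges V - edges S. ?t f) + (\<Sum>f\<in>edges S. ?t f)\<bar>"
    using sum.subset_diff[OF sub edges_finite[OF order_refl], of ?t] by simp
  also have "\<dots> \<le> (\<Sum>f\<in>edges V - edges S. \<bar>?t f\<bar>) + \<bar>\<Sum>f\<in>edges S. ?t f\<bar>"
    using sum_abs[of ?t "edges V - edges S"] by linarith
  also have "(\<Sum>f\<in>edges V - edges S. \<bar>?t f\<bar>) = (\<Sum>f\<in>edges V - edges S. ?g (?\<phi> f))"
  proof (intro sum.cong refl)
    fix f assume "f \<in> edges V - edges S"
    then obtain v u where f: "f = (v, u)" "adj v u" by (auto simp: edges_def)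
    show "\<bar>?t f\<bar> = ?g (?\<phi> f)" unfolding t f(1) using gsym[OF f(2)] by simp
  qed
  also have "\<dots> = (\<Sum>f\<in>?\<phi> ` (edges V - edges S). ?g f)"
    by (subst sum.reindex) (auto simp: inj_on_def edges_def split: if_splits)
  also have "\<dots> \<le> (\<Sum>f\<in>?Q. ?g f)"
  proof (intro sum_mono2 finQ)
    show "?\<phi> ` (edges V - edges S) \<subseteq> ?Q"
    proof
      fix x assume "x \<in> ?\<phi> ` (edges V - edges S)"
      then obtain v u where vu: "v \<in> V" "u \<in> V" "adj v u" "fst v < fst u" "\<not> (v \<in> S \<and> u \<in> S)"
        "x = ?\<phi> (v, u)" by (auto simp: edges_def)
      then show "x \<in> ?Q" using cover[of v u] adj_sym[of v u] by auto
    qed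
    show "0 \<le> ?g f" for f by (cases f) (auto intro!: mult_nonneg_nonneg less_imp_le[OF wt_pos])
  qed
  finally show ?thesis using potency_tilde_ge[OF S] unfolding potency_eq by linarith
qed

text \<open>The factor 2 turns the threshold \<open>L / 5\<close> into the exponent
  \<open>L / 10\<close>. Adjacent vertices lie in different fibres since \<open>H\<close> has no
  loops, so every adjacent pair has exactly one orientation in \<open>edges S\<close>.\<close>

lemma sum_dev_edges:
  assumes S: "S \<subseteq> V"
  shows "(\<Sum>v\<in>S. \<Sum>u\<in>S. dev v u) = 2 * (\<Sum>(v, u)\<in>edges S. dev v u)"
proof -
  have fin: "finite S" using S V_finite finite_subset by blast
  have "(\<Sum>v\<in>S. \<Sum>u\<in>S. dev v u) = (\<Sum>(v, u)\<in>S \<times> S. dev v u)"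
    by (rule sum.cartesian_product)
  also have "\<dots> = (\<Sum>(v, u)\<in>edges S \<union> (edges S)\<inverse>. dev v u)"
  proof (rule sum.mono_neutral_right)
    show "\<forall>f\<in>S \<times> S - (edges S \<union> (edges S)\<inverse>). (case f of (v, u) \<Rightarrow> dev v u) = 0"
    proof
      fix f assume f: "f \<in> S \<times> S - (edges S \<union> (edges S)\<inverse>)"
      obtain v u where vu: "f = (v, u)" by (cases f)
      have "\<not> adj v u"
      proof
        assume adj: "adj v u"
        then have "fst v \<noteq> fst u" using regular by (auto simp: Gamma_adj_def regular_graph_def)
        then show False using f adj adj_sym[of v u] by (auto simp: vu edges_def)
      qed
      then show "(case f of (v, u) \<Rightarrow> dev v u) = 0" by (simp add: vu dev_def)
    qed
  qed (use fin in \<open>auto simp: edges_def\<close>)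
  also have "\<dots> = (\<Sum>(v, u)\<in>edges S. dev v u) + (\<Sum>(v, u)\<in>(edges S)\<inverse>. dev v u)"
    using edges_finite[OF S] by (intro sum.union_disjoint) (auto simp: edges_def)
  also have "(\<Sum>(v, u)\<in>(edges S)\<inverse>. dev v u) = (\<Sum>(v, u)\<in>edges S. dev v u)"
    by (rule sum.reindex_bij_witness[of _ prod.swap prod.swap]) (auto simp: dev_sym)
  finally show ?thesis by simp
qed

section \<open>Union bound over the vertex classes\<close>

definition base_edges :: "(nat \<times> nat) set" where
  "base_edges = {(i, i'). i < i' \<and> i' < h \<and> adjH i i'}"

lemma base_edges_finite: "finite base_edges" and base_edges_card: "card base_edges \<le> h * h"
proof -
  have sub: "base_edges \<subseteq> {..<h} \<times> {..<h}" by (auto simp: base_edges_def)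
  show "finite base_edges" using sub by (rule finite_subset) simp
  show "card base_edges \<le> h * h" using card_mono[OF _ sub] by simp
qed

text \<open>The prescribed value \<open>id\<close> off the base edges makes \<open>lifts\<close> a
  product set with a default; counting in it factors over base edges, which expresses independence
  of the matchings.\<close>

lemma lifts_eq: "lifts adjH h n = PiE_dflt base_edges id (\<lambda>_. {p. p permutes {..<n}})"
  by (auto simp: lifts_def PiE_dflt_def base_edges_def)

lemma finite_lifts: "finite (lifts adjH h n)"
  unfolding lifts_eq using base_edges_finite by (auto intro!: finite_PiE_dflt finite_permutations)

lemma card_lifts: "card (lifts adjH h n) = fact n ^ card base_edges"
  unfolding lifts_eq using base_edges_finite
  by (subst card_PiE_dflt) (auto simp: finite_permutations card_permutations[of _ n])

text \<open>A multiplicative handshake: every fibre meets \<open>d\<close> base edges. It converts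
  the exponent 1/4 per matching into d / 4.\<close>

lemma prod_base_edges:
  fixes g :: "nat \<Rightarrow> real"
  shows "(\<Prod>(i, i')\<in>base_edges. g i * g i') = (\<Prod>i<h. g i ^ d)"
proof -
  have "(\<Prod>(i, i')\<in>base_edges. g i * g i') = (\<Prod>(i, i')\<in>base_edges. g i) * (\<Prod>(i, i')\<in>base_edges. g i')"
    by (simp add: prod.distrib split_def)
  also have "(\<Prod>(i, i')\<in>base_edges. g i') = (\<Prod>(i, i')\<in>base_edges\<inverse>. g i)"
    by (rule prod.reindex_bij_witness[of _ prod.swap prod.swap]) auto
  also have "(\<Prod>(i, i')\<in>base_edges. g i) * (\<Prod>(i, i')\<in>base_edges\<inverse>. g i) =
      (\<Prod>(i, i')\<in>base_edges \<union> base_edges\<inverse>. g i)"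
    using base_edges_finite by (intro prod.union_disjoint[symmetric]) (auto simp: base_edges_def)
  also have "base_edges \<union> base_edges\<inverse> = Sigma {..<h} (\<lambda>i. {i'. adjH i i'})"
  proof -
    have "i < h \<and> i' < h \<and> i \<noteq> i' \<and> adjH i' i" if "adjH i i'" for i i'
      using that regular unfolding regular_graph_def by blast
    then show ?thesis by (fastforce simp: base_edges_def)
  qed
  also have "(\<Prod>(i, i')\<in>Sigma {..<h} (\<lambda>i. {i'. adjH i i'}). g i) = (\<Prod>i<h. \<Prod>i' | adjH i i'. g i)"
    using nbrs_finite by (intro prod.Sigma[symmetric]) auto
  also have "\<dots> = (\<Prod>i<h. g i ^ d)"
    by (intro prod.cong refl) (simp add: card_nbrs)
  finally show ?thesis .
qed

text \<open>The event for one fixed choice of classes. Pairs in \<open>edges S\<close> run from the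
  lower to the higher fibre, the direction in which \<open>\<sigma>\<close> maps.\<close>

definition realising :: "(nat \<times> nat) set \<Rightarrow> (nat \<times> nat \<Rightarrow> nat set) \<Rightarrow> (nat \<times> nat \<Rightarrow> nat \<Rightarrow> nat) set" where
  "realising S A = {\<sigma> \<in> lifts adjH h n.
     \<forall>(v, u)\<in>edges S. card {j \<in> A v. \<sigma> (fst v, fst u) j \<in> A u} = e v u}"

text \<open>The constraints on different base edges involve different permutations, so the count is
  at most the product of the single-matching bounds; those for the pairs of levels join up to the
  edges inside \<open>S\<close>.\<close>

lemma card_realising_le:
  assumes S: "S \<subseteq> V" and A: "\<And>v. v \<in> S \<Longrightarrow> A v \<subseteq> {..<n} \<and> card (A v) = a v"
    and disj: "\<And>v u. v \<in> S \<Longrightarrow> u \<in> S \<Longrightarrow> fst v = fst u \<Longrightarrow> v \<noteq> u \<Longrightarrow> A v \<inter> A u = {}"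
  shows "real (card (realising S A)) \<le> card (lifts adjH h n) * (exp 1 ^ (Suc d * (h * h)) *
    (\<Prod>v\<in>S. real (a v) powr (d / 4)) * exp (- (\<Sum>(v, u)\<in>edges S. dev v u)))"
proof -
  define Lv where "Lv i = {k. (i, k) \<in> S}" for i
  define R where "R i i' = {(k, l). ((i, k), (i', l)) \<in> edges S}" for i i'
  define P where "P i i' = {p. p permutes {..<n} \<and>
    (\<forall>(k, l)\<in>R i i'. card {j\<in>A (i, k). p j \<in> A (i', l)} = e (i, k) (i', l))}" for i i'
  define g where "g i = (\<Prod>k\<in>Lv i. real (a (i, k)) powr (1/4))" for i
  let ?D = "\<lambda>i i'. \<Sum>(k, l)\<in>R i i'. dev (i, k) (i', l)"
  have Lv: "Lv i \<subseteq> levels i" for i using S by (auto simp: Lv_def levels_def V_def)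
  have finLv: "finite (Lv i)" for i using Lv levels_finite finite_subset by blast
  have cardLv: "card (Lv i) \<le> d" for i
    using card_mono[OF levels_finite Lv] levels_card le_trans by blast
  have Rsub: "R i i' \<subseteq> Lv i \<times> Lv i'" for i i' by (auto simp: R_def Lv_def edges_def)
  have finR: "finite (R i i')" for i i' using Rsub finLv by (meson finite_SigmaI finite_subset)
  have "realising S A \<subseteq> PiE_dflt base_edges id (\<lambda>(i, i'). P i i')"
    by (auto simp: realising_def lifts_eq PiE_dflt_def P_def R_def)
  then have "card (realising S A) \<le> card (PiE_dflt base_edges id (\<lambda>(i, i'). P i i'))"
    using base_edges_finite
    by (intro card_mono finite_PiE_dflt) (auto simp: P_def finite_permutations)
  also have "\<dots> = (\<Prod>(i, i')\<in>base_edges. card (P i i'))"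
    using base_edges_finite by (subst card_PiE_dflt) (auto simp: P_def finite_permutations split_def)
  finally have "real (card (realising S A)) \<le> (\<Prod>(i, i')\<in>base_edges. real (card (P i i')))"
    by (metis (mono_tags, lifting) of_nat_le_iff of_nat_prod prod.cong split_def)
  also have "\<dots> \<le> (\<Prod>(i, i')\<in>base_edges. fact n * exp 1 ^ Suc d * (g i * g i') * exp (- ?D i i'))"
  proof (rule prod_mono, clarify)
    fix i i' assume "(i, i') \<in> base_edges"
    have ne: "A (i, k) \<noteq> {}" "A (i, k) \<subseteq> {..<n}" "card (A (i, k)) = a (i, k)" if "k \<in> Lv i" for i k
    proof -
      have "(i, k) \<in> S" "a (i, k) \<noteq> 0" using that S by (auto simp: Lv_def V_def)
      then show "A (i, k) \<noteq> {}" "A (i, k) \<subseteq> {..<n}" "card (A (i, k)) = a (i, k)"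
        using A[of "(i, k)"] by auto
    qed
    have gi: "(\<Prod>k\<in>Lv i. real (card (A (i, k))) powr (1/4)) = g i" for i
      unfolding g_def by (intro prod.cong refl) (simp add: ne)
    have dj: "disjoint_family_on (\<lambda>k. A (i, k)) (Lv i)" for i
      unfolding disjoint_family_on_def using disj by (auto simp: Lv_def)
    have "real (card (P i i')) \<le> fact (card {..<n}) * exp 1 ^ Suc d *
       (\<Prod>k\<in>Lv i. real (card (A (i, k))) powr (1/4)) * (\<Prod>l\<in>Lv i'. real (card (A (i', l))) powr (1/4)) *
       exp (- (\<Sum>(k, l)\<in>R i i'. rel_dev (e (i, k) (i', l)) (card (A (i, k)) * card (A (i', l)) / card {..<n})))"
      unfolding P_def using n_pos ne dj finLv cardLv Rsub
      by (intro card_perms_table_le_rel_dev_sym) (auto simp: lessThan_empty_iff)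
    also have "(\<Sum>(k, l)\<in>R i i'. rel_dev (e (i, k) (i', l)) (card (A (i, k)) * card (A (i', l)) / card {..<n})) = ?D i i'"
    proof (intro sum.cong refl, clarify)
      fix k l assume kl: "(k, l) \<in> R i i'"
      then have "adj (i, k) (i', l)" by (simp add: R_def edges_def)
      moreover have "k \<in> Lv i" "l \<in> Lv i'" using kl Rsub by auto
      ultimately show "rel_dev (e (i, k) (i', l)) (card (A (i, k)) * card (A (i', l)) / card {..<n}) = dev (i, k) (i', l)"
        by (simp add: dev_def mu_def ne)
    qed
    finally show "0 \<le> real (card (P i i')) \<and>
        real (card (P i i')) \<le> fact n * exp 1 ^ Suc d * (g i * g i') * exp (- ?D i i')"
      by (simp add: gi mult_ac)
  qed
  also have "\<dots> = fact n ^ card base_edges * (exp 1 ^ Suc d) ^ card base_edges *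
      (\<Prod>(i, i')\<in>base_edges. g i * g i') * (\<Prod>(i, i')\<in>base_edges. exp (- ?D i i'))"
    by (simp add: prod.distrib split_def power_mult_distrib)
  also have "(\<Prod>(i, i')\<in>base_edges. exp (- ?D i i')) = exp (- (\<Sum>(v, u)\<in>edges S. dev v u))"
  proof -
    have "(\<Sum>(i, i')\<in>base_edges. ?D i i') =
        (\<Sum>x\<in>base_edges. \<Sum>y\<in>R (fst x) (snd x). dev (fst x, fst y) (snd x, snd y))"
      by (simp add: split_def)
    also have "\<dots> = (\<Sum>(x, y)\<in>Sigma base_edges (\<lambda>x. R (fst x) (snd x)). dev (fst x, fst y) (snd x, snd y))"
      using base_edges_finite finR by (intro sum.Sigma) auto
    also have "\<dots> = (\<Sum>(v, u)\<in>edges S. dev v u)"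
      by (rule sum.reindex_bij_witness[of _ "\<lambda>(v, u). ((fst v, fst u), (snd v, snd u))"
            "\<lambda>(x, y). ((fst x, fst y), (snd x, snd y))"])
         (auto simp: R_def base_edges_def edges_def Gamma_adj_def)
    finally show ?thesis using base_edges_finite by (simp add: exp_sum[symmetric] split_def sum_negf)
  qed
  also have "(\<Prod>(i, i')\<in>base_edges. g i * g i') = (\<Prod>v\<in>S. real (a v) powr (d / 4))"
  proof -
    have "g i ^ d = (\<Prod>k\<in>Lv i. real (a (i, k)) powr (d / 4))" for i
      unfolding g_def prod_power_distrib
    proof (intro prod.cong refl)
      fix k assume "k \<in> Lv i"
      then have "0 < real (a (i, k))" using Lv[of i] by (auto simp: levels_def)
      then have "(real (a (i, k)) powr (1/4)) ^ d = (real (a (i, k)) powr (1/4)) powr real d"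
        by (simp add: powr_realpow)
      then show "(real (a (i, k)) powr (1/4)) ^ d = real (a (i, k)) powr (d / 4)"
        by (simp add: powr_powr)
    qed
    then have "(\<Prod>(i, i')\<in>base_edges. g i * g i') = (\<Prod>i<h. \<Prod>k\<in>Lv i. real (a (i, k)) powr (d / 4))"
      unfolding prod_base_edges by simp
    also have "\<dots> = (\<Prod>(i, k)\<in>Sigma {..<h} Lv. real (a (i, k)) powr (d / 4))"
      using finLv by (intro prod.Sigma) auto
    also have "Sigma {..<h} Lv = S" using S V_fst by (fastforce simp: Lv_def)
    finally show ?thesis by (simp add: split_def)
  qed
  also have "fact n ^ card base_edges * (exp 1 ^ Suc d) ^ card base_edges *
      (\<Prod>v\<in>S. real (a v) powr (d / 4)) * exp (- (\<Sum>(v, u)\<in>edges S. dev v u)) \<le>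
      fact n ^ card base_edges * exp 1 ^ (Suc d * (h * h)) *
      (\<Prod>v\<in>S. real (a v) powr (d / 4)) * exp (- (\<Sum>(v, u)\<in>edges S. dev v u))"
    unfolding power_mult[symmetric]
    by (intro mult_right_mono mult_left_mono power_increasing mult_le_mono2 base_edges_card)
       (auto intro!: prod_nonneg)
  finally show ?thesis unfolding card_lifts by (simp add: mult_ac)
qed

text \<open>Restricting the witness to \<open>S\<close> makes it a member of a finite product, the
  index set of the union bound.\<close>

lemma found_in_imp_realising:
  assumes S: "S \<subseteq> V" and \<sigma>: "\<sigma> \<in> lifts adjH h n"
    and found: "found_in adjH d n h \<sigma> (sub_a S a) (sub_e S e)"
  shows "\<exists>A \<in> PiE S (\<lambda>v. {X. X \<subseteq> {..<n} \<and> card X = a v}).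
    (\<forall>v\<in>S. \<forall>u\<in>S. fst v = fst u \<longrightarrow> v \<noteq> u \<longrightarrow> A v \<inter> A u = {}) \<and> \<sigma> \<in> realising S A"
proof -
  obtain A where A: "\<And>v. fst v < h \<Longrightarrow> A v \<subseteq> {..<n} \<and> card (A v) = sub_a S a v"
    "\<And>v u. fst v < h \<Longrightarrow> fst v = fst u \<Longrightarrow> v \<noteq> u \<Longrightarrow> A v \<inter> A u = {}"
    "\<And>v u. adj v u \<Longrightarrow> card {(j, j'). j \<in> A v \<and> j' \<in> A u \<and>
       lift_adj adjH h n \<sigma> (fst v, j) (fst u, j')} = sub_e S e v u"
    using found unfolding found_in_def by blast
  have Sh: "fst v < h" if "v \<in> S" for v using that S V_fst by blast
  have "card {j \<in> A v. \<sigma> (fst v, fst u) j \<in> A u} = e v u" if vu: "(v, u) \<in> edges S" for v u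
  proof -
    have vu': "v \<in> S" "u \<in> S" "adj v u" "fst v < fst u" using vu by (auto simp: edges_def)
    have adjH: "adjH (fst v) (fst u)" using vu' by (simp add: Gamma_adj_def)
    have lt: "j < n" if "j \<in> A v \<or> j \<in> A u" for j
      using that A(1)[OF Sh[OF vu'(1)]] A(1)[OF Sh[OF vu'(2)]] by auto
    \<comment> \<open>The edges between two classes form part of the graph of a permutation, so they
      are counted by their lower endpoints.\<close>
    have "{(j, j'). j \<in> A v \<and> j' \<in> A u \<and> lift_adj adjH h n \<sigma> (fst v, j) (fst u, j')} =
       (\<lambda>j. (j, \<sigma> (fst v, fst u) j)) ` {j \<in> A v. \<sigma> (fst v, fst u) j \<in> A u}"
      using lt vu' adjH Sh by (auto simp: lift_adj_def)
    then have "card {(j, j'). j \<in> A v \<and> j' \<in> A u \<and> lift_adj adjH h n \<sigma> (fst v, j) (fst u, j')} =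
        card {j \<in> A v. \<sigma> (fst v, fst u) j \<in> A u}"
      by (simp add: card_image inj_on_def)
    then show ?thesis using A(3)[OF vu'(3)] vu' by (simp add: sub_e_def)
  qed
  then have "\<sigma> \<in> realising S (restrict A S)"
    using \<sigma> by (auto simp: realising_def edges_def)
  moreover have "restrict A S \<in> PiE S (\<lambda>v. {X. X \<subseteq> {..<n} \<and> card X = a v})"
    using A(1) Sh by (auto simp: sub_a_def)
  moreover have "\<forall>v\<in>S. \<forall>u\<in>S. fst v = fst u \<longrightarrow> v \<noteq> u \<longrightarrow> restrict A S v \<inter> restrict A S u = {}"
    using A(2) Sh by simp
  ultimately show ?thesis by blast
qed

lemma prob_found_le:
  assumes S: "S \<subseteq> V"
  shows "prob_found adjH d n h (sub_a S a) (sub_e S e) \<le>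
    (\<Prod>v\<in>S. real (n choose a v)) * (exp 1 ^ (Suc d * (h * h)) *
      (\<Prod>v\<in>S. real (a v) powr (d / 4)) * exp (- (\<Sum>(v, u)\<in>edges S. dev v u)))"
proof -
  let ?L = "lifts adjH h n"
  let ?A = "PiE S (\<lambda>v. {X. X \<subseteq> {..<n} \<and> card X = a v})"
  let ?A' = "{A \<in> ?A. \<forall>v\<in>S. \<forall>u\<in>S. fst v = fst u \<longrightarrow> v \<noteq> u \<longrightarrow> A v \<inter> A u = {}}"
  let ?M = "exp 1 ^ (Suc d * (h * h)) * (\<Prod>v\<in>S. real (a v) powr (d / 4)) *
    exp (- (\<Sum>(v, u)\<in>edges S. dev v u))"
  let ?F = "?L \<inter> {\<sigma>. found_in adjH d n h \<sigma> (sub_a S a) (sub_e S e)}"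
  have fin: "finite S" using S V_finite finite_subset by blast
  have finA: "finite ?A" using fin by (intro finite_PiE) auto
  have cardA: "card ?A = (\<Prod>v\<in>S. n choose a v)"
    using fin by (simp add: card_PiE n_subsets)
  have L: "0 < card ?L" by (simp add: card_lifts)
  then have L': "?L \<noteq> {}" by force
  have "?F \<subseteq> (\<Union>A\<in>?A'. realising S A)"
  proof
    fix \<sigma> assume "\<sigma> \<in> ?F"
    then obtain A where "A \<in> ?A" "\<sigma> \<in> realising S A"
      "\<forall>v\<in>S. \<forall>u\<in>S. fst v = fst u \<longrightarrow> v \<noteq> u \<longrightarrow> A v \<inter> A u = {}"
      using found_in_imp_realising[OF S, of \<sigma>] by (elim IntE CollectE) blast
    then show "\<sigma> \<in> (\<Union>A\<in>?A'. realising S A)" by (intro UN_I[of A]) auto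
  qed
  then have "card ?F \<le> card (\<Union>A\<in>?A'. realising S A)"
    using finA finite_lifts by (intro card_mono) (auto simp: realising_def)
  also have "\<dots> \<le> (\<Sum>A\<in>?A'. card (realising S A))" using finA by (intro card_UN_le) auto
  finally have "real (card ?F) \<le> (\<Sum>A\<in>?A'. real (card (realising S A)))"
    by (metis (mono_tags, lifting) of_nat_le_iff of_nat_sum sum.cong)
  also have "\<dots> \<le> (\<Sum>A\<in>?A'. card ?L * ?M)"
    by (intro sum_mono card_realising_le[OF S]) auto
  also have "\<dots> = card ?A' * (card ?L * ?M)" by simp
  \<comment> \<open>Disjointness was needed for the bound on each \<open>realising S A\<close>; for
    the number of choices it is given up, leaving a product of binomials.\<close>
  also have "\<dots> \<le> card ?A * (card ?L * ?M)"
    using finA by (intro mult_right_mono mult_nonneg_nonneg) (auto intro!: card_mono prod_nonneg)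
  finally have "real (card ?F) / card ?L \<le> card ?A * ?M"
    using L by (simp add: divide_le_eq mult_ac)
  then show ?thesis
    unfolding prob_found_def using finite_lifts L'
    by (simp add: measure_pmf_of_set cardA)
qed

end

theorem theorem3p6:
  fixes adjH :: "nat \<Rightarrow> nat \<Rightarrow> bool" and h d :: nat and L :: real
  assumes "d \<ge> 2" and "regular_graph adjH h d" and "L \<ge> 20"
  shows "\<exists>C::real. \<forall>n a e. n \<ge> 1 \<longrightarrow> is_pattern adjH d n h a e \<longrightarrow>
    (\<exists>S \<subseteq> {v. fst v < h}.
       potency_tilde adjH d n h (sub_a S a) (sub_e S e)
         \<ge> potency adjH d n h a e / 2 - 55 * L * sqrt (real d) \<and>
       prob_found adjH d n h (sub_a S a) (sub_e S e)
         \<le> C * (\<Prod>v | v \<in> S \<and> a v > 0. real (a v) powr (real d / 4))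
             * (\<Prod>v | v \<in> S \<and> a v > 0. real (n choose min (a v) (n div 2))) powr (1 - L / 10))"
proof (cases "h = 0")
  case True
  \<comment> \<open>Without fibres both potencies vanish and all products are empty, so
    \<open>S = {}\<close> and C = 1 work because a probability is at most 1.\<close>
  then have "Gamma_edges adjH d n h = {}" for n by (auto simp: Gamma_edges_def Gamma_adj_def)
  moreover have "0 \<le> L * sqrt d" using assms by simp
  ultimately show ?thesis
    by (intro exI[of _ 1] allI impI exI[of _ "{}"])
       (auto simp: potency_def potency_tilde_def prob_found_def)
next
  case False
  show ?thesis
  \<comment> \<open>One factor e for each of at most d classes and the leftover class, for each of
    at most h * h base edges.\<close>
  proof (intro exI[of _ "exp 1 ^ (Suc d * (h * h))"] allI impI, goal_cases)
    case (1 n a e)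
    interpret lift_pattern adjH d n h a e
      by unfold_locales (use 1 False assms in auto)
    have b0: "0 \<le> L / 5 * logbinom v" for v using logbinom_nonneg[of v] assms(3) by simp
    obtain S Q where S: "S \<subseteq> V" and Q: "Q \<subseteq> V \<times> V"
      and load: "\<forall>v\<in>V. (\<Sum>u | (v, u) \<in> Q. dev v u) \<le> L / 5 * logbinom v"
      and cover: "\<forall>v\<in>V. \<forall>u\<in>V. v \<in> S \<and> u \<in> S \<or> (v, u) \<in> Q \<or> (u, v) \<in> Q"
      and core: "(\<Sum>v\<in>S. L / 5 * logbinom v) \<le> (\<Sum>v\<in>S. \<Sum>u\<in>S. dev v u)"
      using greedy_deletion[where b = "\<lambda>v. L / 5 * logbinom v" and D = dev, OF V_finite b0] by (elim exE conjE) (rule that)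
    have "potency adjH d n h a e \<le> potency_tilde adjH d n h (sub_a S a) (sub_e S e) + 55 * L * sqrt d"
    proof -
      have "v \<in> S \<and> u \<in> S \<or> (v, u) \<in> Q \<or> (u, v) \<in> Q" if "v \<in> V" "u \<in> V" for v u
        using cover that by blast
      from potency_loss[OF S Q this] loss_bound[OF Q assms(3) bspec[OF load]]
      show ?thesis by linarith
    qed
    \<comment> \<open>The deletion preserves the full potency up to the loss; nonnegativity weakens
      this to the stated half.\<close>
    moreover have "0 \<le> potency adjH d n h a e" by (simp add: potency_def)
    ultimately have pot: "potency adjH d n h a e / 2 - 55 * L * sqrt d \<le>
        potency_tilde adjH d n h (sub_a S a) (sub_e S e)" by linarith
    let ?B = "\<Sum>v\<in>S. logbinom v"
    let ?K = "exp 1 ^ (Suc d * (h * h)) * (\<Prod>v\<in>S. real (a v) powr (d / 4))"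
    have fin: "finite S" using S V_finite finite_subset by blast
    have Seq: "{v. v \<in> S \<and> a v > 0} = S" using S by (auto simp: V_def)
    have bin: "real (n choose min (a v) (n div 2)) = exp (logbinom v)" for v
      unfolding logbinom_def by (subst exp_ln) (auto intro!: zero_less_binomial)
    have "(\<Prod>v\<in>S. real (n choose a v)) \<le> (\<Prod>v\<in>S. exp (logbinom v))"
      unfolding bin[symmetric]
      \<comment> \<open>For \<open>a v\<close> above \<open>n div 2\<close> the truncated binomial
        is the central one, the largest of all.\<close>
      by (intro prod_mono) (auto simp: min_def binomial_maximum)
    also have "\<dots> = exp ?B" using fin by (simp add: exp_sum)
    finally have choices: "(\<Prod>v\<in>S. real (n choose a v)) \<le> exp ?B" .
    have "L / 5 * ?B \<le> 2 * (\<Sum>(v, u)\<in>edges S. dev v u)"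
      using core sum_dev_edges[OF S] by (simp add: sum_distrib_left)
    then have decay: "exp (- (\<Sum>(v, u)\<in>edges S. dev v u)) \<le> exp (- (L / 10 * ?B))" by simp
    have "prob_found adjH d n h (sub_a S a) (sub_e S e) \<le>
        (\<Prod>v\<in>S. real (n choose a v)) * (?K * exp (- (\<Sum>(v, u)\<in>edges S. dev v u)))"
      using prob_found_le[OF S] .
    also have "\<dots> \<le> exp ?B * (?K * exp (- (L / 10 * ?B)))"
      by (intro mult_mono choices mult_left_mono decay) (auto intro!: prod_nonneg mult_nonneg_nonneg)
    also have "\<dots> = ?K * exp ((1 - L / 10) * ?B)"
      by (simp add: exp_add[symmetric] algebra_simps)
    also have "exp ((1 - L / 10) * ?B) = (\<Prod>v\<in>S. real (n choose min (a v) (n div 2))) powr (1 - L / 10)"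
      unfolding bin using fin by (simp add: exp_sum[symmetric] powr_def)
    finally show ?case
      using pot S V_fst by (intro exI[of _ S]) (auto simp: Seq)
  qed
qed

end
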